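(* Assume that $\gamma > 0$ and $C$ is $\gamma$-allowable. Then there exists a matrix $A \in \mathrm{GL}_2(R)$ such that $C' := A\ast_{\varphi} C$ satisfies \begin{enumerate} \item[(a)] $C|_{u=0} = C'|_{u=0}$, \item[(b)] $C' = T(C')$, and \item[(c)] $C'-T(C) \in \begin{pmatrix} H_r & \ast \\ \ast & H_r \end{pmatrix}$ where $r= \varepsilon_C + a' + \min\{\gamma,p-1\}$. \end{enumerate}
   Context: Let $p$ be a prime, $F/\mathbb{Q}_p$ finite with ring of integers $\Lambda$, $m>1$ real. Let $R=\{f=\sum a_iu^i\in F[\![u]\!] : i+m\,v_p(a_i)\to\infty\}$ with $v_R(f)=\min_i\{i+m\,v_p(a_i)\}$, $H_v=\{f\in R:v_R(f)\ge v\}$ (matrix membership entrywise, $\ast$ meaning no condition). $\varphi$ is the $F$-linear map with $\varphi(u)=u^p$ and $A\ast_\varphi C=AC\varphi(A)^{-1}$; $T_{\le n}(\sum a_iu^i)=\sum_{i\le n}a_iu^i$; $(-)|_{u=0}$ means reduction mod $u$. Fix non-negative integers $a,b$ and rationals $b'\ge a'$ with $a+b=a'+b'$; set $N=b$ if $b'=a'$, otherwise $N=b+\lceil (b'-a')/(p-1)\rceil-1$. For $C=(c_{ij})\in M_2(R)$ let $T(C)=\begin{pmatrix} T_{\leq N}(c_{11}) & T_{\leq a}(c_{12})\\ T_{\leq b}(c_{21}) & T_{\leq a}(c_{22})\end{pmatrix}$ and $E(C)=(e_{ij})=C-T(C)$. For $\gamma>0$, $C$ is $\gamma$-allowable if for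 some $c_a,c_b\in\Lambda^\times$, $C \in \begin{pmatrix} 0 & c_a u^a \\ c_bu^b & 0 \end{pmatrix} + \begin{pmatrix} H_{a'+\gamma} & H_{a+\gamma} \\ H_{b+\gamma} & H_{b'+\gamma}\end{pmatrix}$. Its error is $\varepsilon_C=\min\{v_R(e_{11})-a',v_R(e_{12})-a,v_R(e_{21})-b,v_R(e_{22})-b'\}$. *)

theory Defs
  imports "HOL-Analysis.Analysis"
begin

section \<open>Finite extensions of the p-adic numbers\<close>

definition padic_val :: "nat \<Rightarrow> rat \<Rightarrow> ereal" where
  "padic_val p q =
     (if q = 0 then \<infinity>
      else ereal (real (multiplicity (int p) (fst (quotient_of q)))
                - real (multiplicity (int p) (snd (quotient_of q)))))"

text \<open>Additive valuations of rank one (not assumed discrete), with \<open>v 0 = \<infinity>\<close>.\<close>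

definition is_valuation :: "('f::field \<Rightarrow> ereal) \<Rightarrow> bool" where
  "is_valuation v \<longleftrightarrow>
     (\<forall>x. v x \<noteq> -\<infinity>) \<and> (\<forall>x. v x = \<infinity> \<longleftrightarrow> x = 0) \<and>
     (\<forall>x y. v (x * y) = v x + v y) \<and> (\<forall>x y. min (v x) (v y) \<le> v (x + y))"

definition val_limit :: "('f::field \<Rightarrow> ereal) \<Rightarrow> (nat \<Rightarrow> 'f) \<Rightarrow> 'f \<Rightarrow> bool" where
  "val_limit v X l \<longleftrightarrow> (\<lambda>n. v (X n - l)) \<longlonglongrightarrow> \<infinity>"

definition val_Cauchy :: "('f::field \<Rightarrow> ereal) \<Rightarrow> (nat \<Rightarrow> 'f) \<Rightarrow> bool" where
  "val_Cauchy v X \<longleftrightarrow> (\<forall>B::real. \<exists>M. \<forall>i\<ge>M. \<forall>j\<ge>M. ereal B \<le> v (X i - X j))"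

definition rat_closure :: "('f::field_char_0 \<Rightarrow> ereal) \<Rightarrow> 'f set" where
  "rat_closure v = {x. \<exists>q::nat \<Rightarrow> rat. val_limit v (\<lambda>n. of_rat (q n)) x}"

text \<open>
  The type \<open>'f\<close>, with the valuation \<open>v\<close>, is a finite extension of the field of p-adic numbers,
  and \<open>v\<close> is the extension of the p-adic valuation normalised by \<open>v p = 1\<close>.
  The field of p-adic numbers is the completion of the rationals at \<open>p\<close>; inside \<open>'f\<close> it is
  the closure of the rationals, which is required to be complete. The last clause says
  that \<open>'f\<close> is finite-dimensional over it. Completeness of \<open>'f\<close> itself is not part of
  the definition.
\<close>

definition finite_extension_Qp :: "nat \<Rightarrow> ('f::field_char_0 \<Rightarrow> ereal) \<Rightarrow> bool" where
  "finite_extension_Qp p v \<longleftrightarrow>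
     is_valuation v \<and>
     (\<forall>q. v (of_rat q) = padic_val p q) \<and>
     (\<forall>X. range X \<subseteq> rat_closure v \<longrightarrow> val_Cauchy v X \<longrightarrow> (\<exists>l\<in>rat_closure v. val_limit v X l)) \<and>
     (\<exists>B. finite B \<and> (\<forall>x. \<exists>c. c ` B \<subseteq> rat_closure v \<and> x = (\<Sum>b\<in>B. c b * b)))"

definition ring_of_integers :: "('f::field \<Rightarrow> ereal) \<Rightarrow> 'f set" where
  "ring_of_integers v = {x. 0 \<le> v x}"

definition integer_units :: "('f::field \<Rightarrow> ereal) \<Rightarrow> 'f set" where
  "integer_units v = {x \<in> ring_of_integers v. \<exists>y\<in>ring_of_integers v. x * y = 1}"


section \<open>The ring of convergent power series\<close>

definition R_ring :: "('f::field \<Rightarrow> ereal) \<Rightarrow> real \<Rightarrow> 'f fps set" where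
  "R_ring v m = {f. (\<lambda>i. ereal (real i) + ereal m * v (fps_nth f i)) \<longlonglongrightarrow> \<infinity>}"

text \<open>On \<^term>\<open>R_ring v m\<close> the infimum is attained; it is \<open>\<infinity>\<close> exactly for the zero series.\<close>

definition v_R :: "('f::field \<Rightarrow> ereal) \<Rightarrow> real \<Rightarrow> 'f fps \<Rightarrow> ereal" where
  "v_R v m f = (INF i. ereal (real i) + ereal m * v (fps_nth f i))"

definition H :: "('f::field \<Rightarrow> ereal) \<Rightarrow> real \<Rightarrow> ereal \<Rightarrow> 'f fps set" where
  "H v m w = {f \<in> R_ring v m. w \<le> v_R v m f}"

definition phi :: "nat \<Rightarrow> 'f::field fps \<Rightarrow> 'f fps" where
  "phi p f = fps_compose f (fps_X ^ p)"

definition mat2 :: "'a::zero \<Rightarrow> 'a \<Rightarrow> 'a \<Rightarrow> 'a \<Rightarrow> 'a^2^2" where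
  "mat2 x y z w = vector [vector [x, y], vector [z, w]]"

definition M2_R :: "('f::field \<Rightarrow> ereal) \<Rightarrow> real \<Rightarrow> ('f fps^2^2) set" where
  "M2_R v m = {A. \<forall>i j. A $ i $ j \<in> R_ring v m}"

definition GL2_R :: "('f::field \<Rightarrow> ereal) \<Rightarrow> real \<Rightarrow> ('f fps^2^2) set" where
  "GL2_R v m = {A \<in> M2_R v m. \<exists>B\<in>M2_R v m. A ** B = mat 1 \<and> B ** A = mat 1}"

definition phi_conj :: "nat \<Rightarrow> 'f::field fps^2^2 \<Rightarrow> 'f fps^2^2 \<Rightarrow> 'f fps^2^2" where
  "phi_conj p A C = A ** C ** matrix_inv (map_matrix (phi p) A)"

definition mod_u :: "'f::field fps^2^2 \<Rightarrow> 'f^2^2" where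
  "mod_u C = map_matrix (\<lambda>f. fps_nth f 0) C"


section \<open>Truncations, errors and allowable matrices\<close>

text \<open>\<^const>\<open>fps_cutoff\<close> keeps the coefficients of index strictly below its first argument.\<close>

definition trunc_le :: "nat \<Rightarrow> 'f::field fps \<Rightarrow> 'f fps" where
  "trunc_le n f = fps_cutoff (Suc n) f"

definition N_bound :: "nat \<Rightarrow> nat \<Rightarrow> rat \<Rightarrow> rat \<Rightarrow> nat" where
  "N_bound p b a' b' =
     (if b' = a' then b else nat (int b + \<lceil>(b' - a') / (of_nat p - 1)\<rceil> - 1))"

definition T :: "nat \<Rightarrow> nat \<Rightarrow> nat \<Rightarrow> rat \<Rightarrow> rat \<Rightarrow> 'f::field fps^2^2 \<Rightarrow> 'f fps^2^2" where
  "T p a b a' b' C =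
     mat2 (trunc_le (N_bound p b a' b') (C $ 1 $ 1)) (trunc_le a (C $ 1 $ 2))
          (trunc_le b (C $ 2 $ 1))                   (trunc_le a (C $ 2 $ 2))"

definition E :: "nat \<Rightarrow> nat \<Rightarrow> nat \<Rightarrow> rat \<Rightarrow> rat \<Rightarrow> 'f::field fps^2^2 \<Rightarrow> 'f fps^2^2" where
  "E p a b a' b' C = C - T p a b a' b' C"

definition allowable ::
  "('f::field \<Rightarrow> ereal) \<Rightarrow> real \<Rightarrow> nat \<Rightarrow> nat \<Rightarrow> rat \<Rightarrow> rat \<Rightarrow> real \<Rightarrow> 'f fps^2^2 \<Rightarrow> bool" where
  "allowable v m a b a' b' \<gamma> C \<longleftrightarrow>
     (\<exists>ca\<in>integer_units v. \<exists>cb\<in>integer_units v.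
        let D = C - mat2 0 (fps_const ca * fps_X ^ a) (fps_const cb * fps_X ^ b) 0 in
          D $ 1 $ 1 \<in> H v m (ereal (of_rat a' + \<gamma>)) \<and>
          D $ 1 $ 2 \<in> H v m (ereal (real a + \<gamma>)) \<and>
          D $ 2 $ 1 \<in> H v m (ereal (real b + \<gamma>)) \<and>
          D $ 2 $ 2 \<in> H v m (ereal (of_rat b' + \<gamma>)))"

text \<open>The error is \<open>\<infinity>\<close> when \<open>C = T C\<close>.\<close>

definition err ::
  "('f::field \<Rightarrow> ereal) \<Rightarrow> real \<Rightarrow> nat \<Rightarrow> nat \<Rightarrow> nat \<Rightarrow> rat \<Rightarrow> rat \<Rightarrow> 'f fps^2^2 \<Rightarrow> ereal" where
  "err v m p a b a' b' C =
     Min {v_R v m (E p a b a' b' C $ 1 $ 1) - ereal (of_rat a'),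
          v_R v m (E p a b a' b' C $ 1 $ 2) - ereal (real a),
          v_R v m (E p a b a' b' C $ 2 $ 1) - ereal (real b),
          v_R v m (E p a b a' b' C $ 2 $ 2) - ereal (of_rat b')}"

end

theory Submission
  imports Defs
begin

text \<open>
  Write \<open>C = C\<^sub>0 + D\<close> with \<open>C\<^sub>0\<close> antidiagonal. Looking for \<open>A = 1 + X\<close> and \<open>C' = T(C) + Y\<close> with
  \<open>A C = C' \<phi>(A)\<close>, \<open>T(Y) = Y\<close>, the substitution \<open>M = X C\<^sub>0 - Y\<close>, so \<open>X = (M - T(M)) C\<^sub>0\<^sup>-\<^sup>1\<close> and
  \<open>Y = -T(M)\<close>, turns the equation into a fixed point equation for \<open>M\<close>. The truncation degrees make \<open>X\<close>
  divisible by \<open>u\<close>, and its upper right entry divisible by \<open>u^(N+1-b)\<close>, so that \<open>\<phi>(X)\<close> is smaller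
  than \<open>X\<close> by enough to make the map a contraction for a suitably weighted Gauss valuation on
  matrices with \<open>v_R\<close> at least the error. The field is complete because it is finite-dimensional over
  a complete subfield, hence so is \<open>R\<close> on such balls. Substituting the solution once more into the
  equation gives the gain \<open>min{\<gamma>, p-1}\<close> in the diagonal entries of \<open>Y\<close>.
\<close>


section \<open>Valued fields and completeness\<close>

lemma val_limit_iff: "val_limit v X l \<longleftrightarrow> (\<forall>t. \<forall>\<^sub>F n in sequentially. ereal t \<le> v (X n - l))"
proof -
  have "\<forall>\<^sub>F n in sequentially. ereal t < v (X n - l)"
    if "\<forall>t. \<forall>\<^sub>F n in sequentially. ereal t \<le> v (X n - l)" for t
    using that[rule_format, of "t + 1"] by eventually_elim (auto intro: less_le_trans[rotated])
  then show ?thesis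
    unfolding val_limit_def tendsto_PInfty by (blast intro: eventually_mono less_imp_le)
qed

locale valued_field =
  fixes v :: "'f::field \<Rightarrow> ereal"
  assumes valuation: "is_valuation v"
begin

lemma v_not_MInf [simp]: "v x \<noteq> -\<infinity>" and v_eq_PInf_iff [simp]: "v x = \<infinity> \<longleftrightarrow> x = 0"
  and v_mult: "v (x * y) = v x + v y" and v_add_min: "min (v x) (v y) \<le> v (x + y)"
  using valuation unfolding is_valuation_def by blast+

lemma v_0 [simp]: "v 0 = \<infinity>"
  by simp

lemma v_1 [simp]: "v 1 = 0"
proof -
  have "v 1 = v 1 + v 1" "v 1 \<noteq> \<infinity>"
    using v_mult[of 1 1] by simp_all
  then show ?thesis
    using v_not_MInf[of 1] by (cases "v 1") (auto simp: zero_ereal_def)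
qed

lemma v_minus [simp]: "v (- x) = v x"
proof -
  have "v (- 1) + v (- 1) = 0"
    using v_mult[of "- 1" "- 1"] by simp
  then have "v (- 1) = 0"
    using v_not_MInf[of "- 1"] by (cases "v (- 1)") (auto simp: zero_ereal_def)
  then show ?thesis
    using v_mult[of "- 1" x] by simp
qed

lemma v_minus_commute: "v (x - y) = v (y - x)"
  using v_minus[of "x - y"] by simp

lemma v_add_ge: "t \<le> v x \<Longrightarrow> t \<le> v y \<Longrightarrow> t \<le> v (x + y)"
  using v_add_min[of x y] by (meson min.boundedI order_trans)

lemma v_diff_ge: "t \<le> v x \<Longrightarrow> t \<le> v y \<Longrightarrow> t \<le> v (x - y)"
  using v_add_ge[of t x "- y"] by simp

lemma v_mult_ge: "ereal s \<le> v x \<Longrightarrow> ereal t \<le> v y \<Longrightarrow> ereal (s + t) \<le> v (x * y)"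
  using add_mono[of "ereal s" "v x" "ereal t" "v y"] by (simp add: v_mult)

lemma v_sum_ge: "(\<And>i. i \<in> A \<Longrightarrow> t \<le> v (f i)) \<Longrightarrow> t \<le> v (sum f A)"
  by (induction A rule: infinite_finite_induct) (auto intro: v_add_ge)

lemma v_ge_all_imp_0: "(\<And>t. ereal t \<le> v x) \<Longrightarrow> x = 0"
  by (metis ereal_top v_eq_PInf_iff)

lemma v_lower_bound: obtains t where "ereal t \<le> v x"
  using v_not_MInf[of x] by (cases "v x") auto

lemma v_finite: assumes "x \<noteq> 0" obtains t where "v x = ereal t"
  using v_not_MInf[of x] v_eq_PInf_iff[of x] assms by (cases "v x") auto

lemma v_inverse: "x \<noteq> 0 \<Longrightarrow> v x = ereal t \<Longrightarrow> v (inverse x) = ereal (- t)"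
  using v_mult[of x "inverse x"] v_not_MInf[of "inverse x"]
  by (cases "v (inverse x)") (auto simp: zero_ereal_def)

section \<open>Limits and the field operations\<close>

lemma val_limit_unique: "val_limit v X l \<Longrightarrow> val_limit v X l' \<Longrightarrow> l = l'"
proof -
  assume a: "val_limit v X l" "val_limit v X l'"
  have "ereal t \<le> v (l - l')" for t
  proof -
    have "\<forall>\<^sub>F n in sequentially. ereal t \<le> v (X n - l) \<and> ereal t \<le> v (X n - l')"
      using a unfolding val_limit_iff by (auto intro: eventually_conj)
    then obtain n where "ereal t \<le> v (X n - l)" "ereal t \<le> v (X n - l')"
      by (metis (mono_tags, lifting) eventually_happens' sequentially_bot)
    then show ?thesis
      using v_diff_ge[of "ereal t" "X n - l'" "X n - l"] by (simp add: algebra_simps)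
  qed
  then show "l = l'"
    using v_ge_all_imp_0[of "l - l'"] by simp
qed

lemma val_limit_const: "val_limit v (\<lambda>n. l) l"
  by (simp add: val_limit_iff)

lemma val_limit_add:
  assumes "val_limit v X x" "val_limit v Y y"
  shows "val_limit v (\<lambda>n. X n + Y n) (x + y)"
  unfolding val_limit_iff
proof
  fix t
  have "\<forall>\<^sub>F n in sequentially. ereal t \<le> v (X n - x) \<and> ereal t \<le> v (Y n - y)"
    using assms unfolding val_limit_iff by (auto intro: eventually_conj)
  then show "\<forall>\<^sub>F n in sequentially. ereal t \<le> v (X n + Y n - (x + y))"
  proof eventually_elim
    case (elim n)
    then show ?case
      using v_add_ge[of "ereal t" "X n - x" "Y n - y"] by (simp add: algebra_simps)
  qed
qed

lemma val_limit_mult: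
  assumes "val_limit v X x" "val_limit v Y y"
  shows "val_limit v (\<lambda>n. X n * Y n) (x * y)"
  unfolding val_limit_iff
proof
  fix t
  obtain s where s: "ereal s \<le> v x" by (rule v_lower_bound)
  obtain r where r: "ereal r \<le> v y" by (rule v_lower_bound)
  have "\<forall>\<^sub>F n in sequentially. ereal (t - r) \<le> v (X n - x) \<and> ereal (t - s) \<le> v (Y n - y)
         \<and> ereal r \<le> v (Y n - y)"
    using assms unfolding val_limit_iff by (intro eventually_conj) auto
  then show "\<forall>\<^sub>F n in sequentially. ereal t \<le> v (X n * Y n - x * y)"
  proof eventually_elim
    case (elim n)
    have "ereal r \<le> v (Y n)"
      using v_add_ge[of "ereal r" "Y n - y" y] elim r by simp
    then have "ereal t \<le> v ((X n - x) * Y n)"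
      using v_mult_ge[of "t - r" "X n - x" r "Y n"] elim by simp
    moreover have "ereal t \<le> v (x * (Y n - y))"
      using v_mult_ge[OF s, of "t - s" "Y n - y"] elim by simp
    ultimately show ?case
      using v_add_ge[of "ereal t" "(X n - x) * Y n" "x * (Y n - y)"] by (simp add: algebra_simps)
  qed
qed

text \<open>\<open>inverse (X n) - inverse x = - (X n - x) / (X n * x)\<close>. The bound
  \<open>s + 1\<close> keeps \<open>X n\<close> nonzero with valuation at most
  \<open>s = v x\<close>, so the denominator costs at most \<open>2 * s\<close>, which the bound
  \<open>t + 2 * s + 1\<close> absorbs.\<close>

lemma val_limit_inverse:
  assumes X: "val_limit v X x" and x: "x \<noteq> 0"
  shows "val_limit v (\<lambda>n. inverse (X n)) (inverse x)"
  unfolding val_limit_iff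
proof
  fix t
  obtain s where s: "v x = ereal s" using v_finite[OF x] .
  have "\<forall>\<^sub>F n in sequentially. ereal (s + 1) \<le> v (X n - x) \<and> ereal (t + 2 * s + 1) \<le> v (X n - x)"
    using X unfolding val_limit_iff by (auto intro: eventually_conj)
  then show "\<forall>\<^sub>F n in sequentially. ereal t \<le> v (inverse (X n) - inverse x)"
  proof eventually_elim
    case (elim n)
    have nz: "X n \<noteq> 0"
    proof
      assume "X n = 0"
      then show False using elim s by simp
    qed
    obtain r where r: "v (X n) = ereal r" using v_finite[OF nz] .
    have "r \<le> s"
    proof (rule ccontr)
      assume "\<not> r \<le> s"
      then have "ereal (min r (s + 1)) \<le> v (X n - (X n - x))"
        using v_diff_ge[of "ereal (min r (s + 1))" "X n" "X n - x"]
          order_trans[of "ereal (min r (s + 1))" "ereal (s + 1)" "v (X n - x)"] elim(1)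
        by (simp add: r del: ereal_min)
      then show False using s \<open>\<not> r \<le> s\<close> by (simp del: ereal_min)
    qed
    have "ereal ((- r) + (- s)) \<le> v (inverse (X n) * inverse x)"
      using v_inverse[OF nz r] v_inverse[OF x s] by (intro v_mult_ge) auto
    then have "ereal (((- r) + (- s)) + (t + 2 * s + 1)) \<le> v ((inverse (X n) * inverse x) * (X n - x))"
      using elim v_mult_ge by blast
    moreover have "(inverse (X n) * inverse x) * (X n - x) = - (inverse (X n) - inverse x)"
      using nz x by (simp add: field_simps)
    ultimately have "ereal (((- r) + (- s)) + (t + 2 * s + 1)) \<le> v (inverse (X n) - inverse x)"
      by (metis v_minus)
    moreover have "t \<le> ((- r) + (- s)) + (t + 2 * s + 1)"
      using \<open>r \<le> s\<close> by simp
    ultimately show ?case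
      by (metis ereal_less_eq(3) order_trans)
  qed
qed

section \<open>Complete subspaces over a complete subfield\<close>

definition complete_in :: "'f set \<Rightarrow> bool" where
  "complete_in V \<longleftrightarrow> (\<forall>X. range X \<subseteq> V \<longrightarrow> val_Cauchy v X \<longrightarrow> (\<exists>l\<in>V. val_limit v X l))"

text \<open>A complete subspace is closed, so a vector outside it has positive distance from it.\<close>

lemma complete_in_distance:
  assumes V: "complete_in V" and b: "b \<notin> V"
  obtains \<delta> :: real where "\<And>y. y \<in> V \<Longrightarrow> v (b - y) \<le> ereal \<delta>"
proof -
  have "\<exists>\<delta>::real. \<forall>y\<in>V. v (b - y) \<le> ereal \<delta>"
  proof (rule ccontr)
    assume "\<not> ?thesis"
    then have "\<forall>n::nat. \<exists>y\<in>V. ereal (real n) \<le> v (b - y)"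
      by (meson linorder_le_cases)
    then obtain Y where Y: "\<And>n. Y n \<in> V" "\<And>n. ereal (real n) \<le> v (b - Y n)"
      by metis
    have lim: "val_limit v Y b"
      unfolding val_limit_iff
    proof
      fix t
      obtain n0 where "t \<le> real n0" using real_arch_simple by blast
      then show "\<forall>\<^sub>F n in sequentially. ereal t \<le> v (Y n - b)"
        using Y(2) by (intro eventually_sequentiallyI[of n0])
          (metis ereal_less_eq(3) of_nat_le_iff order_trans v_minus_commute)
    qed
    have "val_Cauchy v Y"
      unfolding val_Cauchy_def
    proof
      fix t
      obtain n0 where n0: "\<And>n. n \<ge> n0 \<Longrightarrow> ereal t \<le> v (Y n - b)"
        using lim unfolding val_limit_iff eventually_sequentially by blast
      then show "\<exists>M. \<forall>i\<ge>M. \<forall>j\<ge>M. ereal t \<le> v (Y i - Y j)"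
        using v_diff_ge[of "ereal t" "Y _ - b" "Y _ - b"] by (intro exI[of _ n0]) auto
    qed
    then obtain l where "l \<in> V" "val_limit v Y l"
      using V Y(1) unfolding complete_in_def by blast
    then show False
      using val_limit_unique[OF lim] b by simp
  qed
  then show ?thesis using that by blast
qed

text \<open>The coefficients of \<open>b\<close> in a Cauchy sequence are themselves Cauchy because
  \<open>b\<close> has positive distance from \<open>V\<close>; subtracting the convergent multiples
  of \<open>b\<close> leaves a Cauchy sequence in \<open>V\<close>.\<close>

lemma complete_in_extend:
  assumes Q: "complete_in Q" "0 \<in> Q"
      "\<And>x y. x \<in> Q \<Longrightarrow> y \<in> Q \<Longrightarrow> x - y \<in> Q" "\<And>x. x \<in> Q \<Longrightarrow> inverse x \<in> Q"
    and V: "complete_in V" "\<And>x y. x \<in> V \<Longrightarrow> y \<in> V \<Longrightarrow> x - y \<in> V"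
      "\<And>c x. c \<in> Q \<Longrightarrow> x \<in> V \<Longrightarrow> c * x \<in> V"
    and b: "b \<notin> V"
  shows "complete_in {c * b + y | c y. c \<in> Q \<and> y \<in> V}"
  unfolding complete_in_def
proof (intro allI impI)
  fix X
  assume X: "range X \<subseteq> {c * b + y | c y. c \<in> Q \<and> y \<in> V}" and cau: "val_Cauchy v X"
  have "\<forall>n. \<exists>c y. X n = c * b + y \<and> c \<in> Q \<and> y \<in> V"
    using X by blast
  then obtain c y where c: "\<And>n. c n \<in> Q" and y: "\<And>n. y n \<in> V"
    and Xcy: "\<And>n. X n = c n * b + y n"
    by metis
  obtain \<delta> where \<delta>: "\<And>y. y \<in> V \<Longrightarrow> v (b - y) \<le> ereal \<delta>"
    using complete_in_distance[OF V(1) b] by blast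
  have neg: "- z \<in> V" if "z \<in> V" for z
    using V(2)[OF V(2)[OF that that] that] by simp
  \<comment> \<open>Factoring out \<open>d\<close> reduces this to the distance from
    \<open>b\<close> to \<open>- (inverse d * z)\<close>, a point of \<open>V\<close>. The bound
    does not depend on \<open>z\<close>, so a small combination has a small coefficient
    \<open>d\<close>.\<close>
  have dist: "v (d * b + z) \<le> v d + ereal \<delta>" if "d \<in> Q" "z \<in> V" for d z
  proof (cases "d = 0")
    case False
    have "d * b + z = d * (b - (- (inverse d * z)))"
      using False by (simp add: field_simps)
    moreover have "- (inverse d * z) \<in> V"
      using Q(4) V(3) neg that by blast
    ultimately show ?thesis
      using \<delta> by (metis add_left_mono v_mult)
  qed simp
  have "val_Cauchy v c"
    unfolding val_Cauchy_def
  proof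
    fix t :: real
    obtain M where M: "\<And>i j. i \<ge> M \<Longrightarrow> j \<ge> M \<Longrightarrow> ereal (t + \<delta>) \<le> v (X i - X j)"
      using cau unfolding val_Cauchy_def by blast
    have "ereal t \<le> v (c i - c j)" if "i \<ge> M" "j \<ge> M" for i j
    proof -
      have "X i - X j = (c i - c j) * b + (y i - y j)"
        by (simp add: Xcy algebra_simps)
      then have "ereal (t + \<delta>) \<le> v (c i - c j) + ereal \<delta>"
        using M[OF that] dist[OF Q(3)[OF c c] V(2)[OF y y], of i j i j] by simp
      then show ?thesis
        by (cases "v (c i - c j)") auto
    qed
    then show "\<exists>M. \<forall>i\<ge>M. \<forall>j\<ge>M. ereal t \<le> v (c i - c j)"
      by blast
  qed
  moreover have "range c \<subseteq> Q" using c by blast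
  ultimately obtain c0 where c0: "c0 \<in> Q" "val_limit v c c0"
    using Q(1) unfolding complete_in_def by blast
  have cb: "val_limit v (\<lambda>n. - (c n * b)) (- (c0 * b))"
    using val_limit_mult[OF c0(2) val_limit_const[of "- b"]] by simp
  have "val_Cauchy v y"
    unfolding val_Cauchy_def
  proof
    fix t :: real
    obtain M where M: "\<And>i j. i \<ge> M \<Longrightarrow> j \<ge> M \<Longrightarrow> ereal t \<le> v (X i - X j)"
      using cau unfolding val_Cauchy_def by blast
    obtain M' where M': "\<And>i. i \<ge> M' \<Longrightarrow> ereal t \<le> v (- (c i * b) - (- (c0 * b)))"
      using cb unfolding val_limit_iff eventually_sequentially by blast
    have "ereal t \<le> v (y i - y j)" if "i \<ge> max M M'" "j \<ge> max M M'" for i j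
    proof -
      have "y i - y j = (X i - X j) + ((- (c i * b) - (- (c0 * b))) - (- (c j * b) - (- (c0 * b))))"
        by (simp add: Xcy)
      then show ?thesis
        using v_add_ge[OF M[of i j] v_diff_ge[OF M'[of i] M'[of j]]] that by simp
    qed
    then show "\<exists>M. \<forall>i\<ge>M. \<forall>j\<ge>M. ereal t \<le> v (y i - y j)"
      by blast
  qed
  moreover have "range y \<subseteq> V" using y by blast
  ultimately obtain y0 where y0: "y0 \<in> V" "val_limit v y y0"
    using V(1) unfolding complete_in_def by blast
  have "val_limit v X (c0 * b + y0)"
    using val_limit_add[OF val_limit_mult[OF c0(2) val_limit_const[of b]] y0(2)]
    by (simp add: Xcy[abs_def])
  then show "\<exists>l\<in>{c * b + y | c y. c \<in> Q \<and> y \<in> V}. val_limit v X l"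
    using c0(1) y0(1) by blast
qed

text \<open>Induction on \<open>B\<close>: a vector already in the subspace leaves it unchanged, any
  other is adjoined by \<open>complete_in_extend\<close>. Thus \<open>B\<close> may be linearly
  dependent.\<close>

lemma complete_in_finite_dimensional:
  assumes Q: "complete_in Q" "0 \<in> Q" "1 \<in> Q"
      "\<And>x y. x \<in> Q \<Longrightarrow> y \<in> Q \<Longrightarrow> x - y \<in> Q" "\<And>x y. x \<in> Q \<Longrightarrow> y \<in> Q \<Longrightarrow> x * y \<in> Q"
      "\<And>x. x \<in> Q \<Longrightarrow> inverse x \<in> Q"
    and "finite B"
  shows "\<exists>V. complete_in V \<and> 0 \<in> V \<and> B \<subseteq> V \<and> (\<forall>x\<in>V. \<forall>y\<in>V. x - y \<in> V) \<and>
             (\<forall>c\<in>Q. \<forall>x\<in>V. c * x \<in> V)"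
  using \<open>finite B\<close>
proof (induction B rule: finite_induct)
  case empty
  have "complete_in {0}"
    unfolding complete_in_def
  proof (intro allI impI)
    fix X :: "nat \<Rightarrow> 'f"
    assume "range X \<subseteq> {0}"
    then have "X = (\<lambda>n. 0)" by auto
    then show "\<exists>l\<in>{0}. val_limit v X l"
      using val_limit_const by simp
  qed
  then show ?case by (intro exI[of _ "{0}"]) auto
next
  case (insert b B)
  then obtain V where V: "complete_in V" "0 \<in> V" "B \<subseteq> V" "\<And>x y. x \<in> V \<Longrightarrow> y \<in> V \<Longrightarrow> x - y \<in> V"
      "\<And>c x. c \<in> Q \<Longrightarrow> x \<in> V \<Longrightarrow> c * x \<in> V"
    by blast
  show ?case
  proof (cases "b \<in> V")
    case True
    then show ?thesis using V by (intro exI[of _ V]) auto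
  next
    case False
    define W where "W = {c * b + y | c y. c \<in> Q \<and> y \<in> V}"
    have memW: "c * b + y \<in> W" if "c \<in> Q" "y \<in> V" for c y
      using that unfolding W_def by blast
    have "complete_in W"
      unfolding W_def using complete_in_extend[OF Q(1,2,4,6) V(1,4,5) False] by blast
    moreover have "insert b B \<subseteq> W"
      using memW[OF Q(3) V(2)] memW[OF Q(2)] V(3) by auto
    moreover have "0 \<in> W"
      using memW[OF Q(2) V(2)] by simp
    moreover have "x - y \<in> W" if xy: "x \<in> W" "y \<in> W" for x y
    proof -
      obtain c z d w where "x = c * b + z" "y = d * b + w" "c \<in> Q" "d \<in> Q" "z \<in> V" "w \<in> V"
        using xy unfolding W_def by blast
      then show ?thesis
        using memW[OF Q(4)[of c d] V(4)[of z w]] by (simp add: algebra_simps)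
    qed
    moreover have "e * x \<in> W" if ex: "e \<in> Q" "x \<in> W" for e x
    proof -
      obtain c z where "x = c * b + z" "c \<in> Q" "z \<in> V"
        using ex unfolding W_def by blast
      then show ?thesis
        using memW[OF Q(5)[of e c] V(5)[of e z]] ex by (simp add: algebra_simps)
    qed
    ultimately show ?thesis by (intro exI[of _ W]) blast
  qed
qed

end

text \<open>The limit laws make the closure of the rationals a field, which is complete by
  definition. A complete subspace over it that contains the finite spanning set is the whole
  field.\<close>

lemma finite_extension_Qp_complete:
  fixes v :: "'f::field_char_0 \<Rightarrow> ereal"
  assumes F: "finite_extension_Qp p v" and X: "val_Cauchy v X"
  shows "\<exists>l. val_limit v X l"
proof -
  interpret valued_field v
    using F by unfold_locales (simp add: finite_extension_Qp_def)
  let ?Q = "rat_closure v"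
  have const: "of_rat q \<in> ?Q" for q
    unfolding rat_closure_def using val_limit_const by (auto intro!: exI[of _ "\<lambda>n. q"])
  have mult: "x * y \<in> ?Q" if xy: "x \<in> ?Q" "y \<in> ?Q" for x y
  proof -
    obtain q r where "val_limit v (\<lambda>n. of_rat (q n)) x" "val_limit v (\<lambda>n. of_rat (r n)) y"
      using xy unfolding rat_closure_def by blast
    then have "val_limit v (\<lambda>n. of_rat (q n * r n)) (x * y)"
      using val_limit_mult by (simp add: of_rat_mult)
    then show ?thesis unfolding rat_closure_def by (intro CollectI exI[of _ "\<lambda>n. q n * r n"])
  qed
  have add: "x + y \<in> ?Q" if xy: "x \<in> ?Q" "y \<in> ?Q" for x y
  proof -
    obtain q r where "val_limit v (\<lambda>n. of_rat (q n)) x" "val_limit v (\<lambda>n. of_rat (r n)) y"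
      using xy unfolding rat_closure_def by blast
    then have "val_limit v (\<lambda>n. of_rat (q n + r n)) (x + y)"
      using val_limit_add by (simp add: of_rat_add)
    then show ?thesis unfolding rat_closure_def by (intro CollectI exI[of _ "\<lambda>n. q n + r n"])
  qed
  have diff: "x - y \<in> ?Q" if "x \<in> ?Q" "y \<in> ?Q" for x y
    using add[OF that(1) mult[OF const[of "- 1"] that(2)]] by (simp add: of_rat_minus)
  have inv: "inverse x \<in> ?Q" if x: "x \<in> ?Q" for x
  proof (cases "x = 0")
    case False
    obtain q where "val_limit v (\<lambda>n. of_rat (q n)) x"
      using x unfolding rat_closure_def by blast
    then have "val_limit v (\<lambda>n. of_rat (inverse (q n))) (inverse x)"
      using val_limit_inverse False by (simp add: of_rat_inverse)
    then show ?thesis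
      unfolding rat_closure_def by (intro CollectI exI[of _ "\<lambda>n. inverse (q n)"])
  qed (use x in simp)
  have "complete_in ?Q"
    using F unfolding finite_extension_Qp_def complete_in_def by blast
  moreover obtain B where "finite B" and B: "\<And>x. \<exists>c. c ` B \<subseteq> ?Q \<and> x = (\<Sum>b\<in>B. c b * b)"
    using F unfolding finite_extension_Qp_def by blast
  ultimately obtain V where V: "complete_in V" "0 \<in> V" "B \<subseteq> V"
      "\<And>x y. x \<in> V \<Longrightarrow> y \<in> V \<Longrightarrow> x - y \<in> V" "\<And>c x. c \<in> ?Q \<Longrightarrow> x \<in> V \<Longrightarrow> c * x \<in> V"
    using complete_in_finite_dimensional[of ?Q B] const[of 0] const[of 1] mult diff inv
    by auto
  have V_add: "x + y \<in> V" if "x \<in> V" "y \<in> V" for x y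
    using V(4)[OF that(1) V(4)[OF V(2) that(2)]] by simp
  have sumV: "sum f A \<in> V" if "\<And>i. i \<in> A \<Longrightarrow> f i \<in> V" for f :: "'f \<Rightarrow> 'f" and A
    using that by (induction A rule: infinite_finite_induct) (auto intro: V(2) V_add)
  have "x \<in> V" for x
  proof -
    obtain c where "c ` B \<subseteq> ?Q" "x = (\<Sum>b\<in>B. c b * b)"
      using B by blast
    then show ?thesis
      using V(3,5) by (auto intro!: sumV)
  qed
  then show ?thesis
    using V(1) X unfolding complete_in_def by blast
qed


section \<open>The Gauss valuation and the ring of convergent series\<close>

unbundle no vec_syntax and fps_syntax

locale gauss_valued_field = valued_field v for v :: "'f::field \<Rightarrow> ereal" +
  fixes m :: real
  assumes m_pos: "0 < m"
begin

text \<open>The inequality \<open>w \<le> v_R f\<close>, with all arithmetic on the real side to avoid extended reals.\<close>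

definition gauss_ge :: "real \<Rightarrow> 'f fps \<Rightarrow> bool" where
  "gauss_ge w f \<longleftrightarrow> (\<forall>i. ereal ((w - real i) / m) \<le> v (f $ i))"

lemma weighted_le_iff: "ereal w \<le> ereal (real i) + ereal m * v x \<longleftrightarrow> ereal ((w - real i) / m) \<le> v x"
  using m_pos v_not_MInf[of x] by (cases "v x") (auto simp: field_simps)

lemma gauss_ge_iff: "gauss_ge w f \<longleftrightarrow> ereal w \<le> v_R v m f"
  by (simp add: gauss_ge_def v_R_def le_INF_iff weighted_le_iff)

lemma R_ring_iff:
  "f \<in> R_ring v m \<longleftrightarrow> (\<forall>w. \<forall>\<^sub>F i in sequentially. ereal ((w - real i) / m) \<le> v (f $ i))"
proof -
  have "((\<lambda>i. ereal (real i) + ereal m * v (f $ i)) \<longlonglongrightarrow> \<infinity>) \<longleftrightarrow>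
        (\<forall>w. \<forall>\<^sub>F i in sequentially. ereal w \<le> ereal (real i) + ereal m * v (f $ i))" (is "?L \<longleftrightarrow> ?R")
  proof
    assume ?L
    then show ?R unfolding tendsto_PInfty by (blast intro: eventually_mono less_imp_le)
  next
    assume R: ?R
    show ?L
      unfolding tendsto_PInfty
    proof
      fix w
      show "\<forall>\<^sub>F i in sequentially. ereal w < ereal (real i) + ereal m * v (f $ i)"
        using R[rule_format, of "w + 1"]
        by (rule eventually_mono) (auto intro: less_le_trans[rotated])
    qed
  qed
  then show ?thesis by (simp add: R_ring_def weighted_le_iff)
qed

lemma gauss_ge_mono: "gauss_ge w f \<Longrightarrow> w' \<le> w \<Longrightarrow> gauss_ge w' f"
  unfolding gauss_ge_iff by (meson ereal_less_eq(3) order_trans)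

lemma gauss_ge_0 [simp]: "gauss_ge w 0"
  by (simp add: gauss_ge_def)

lemma gauss_ge_add: "gauss_ge w f \<Longrightarrow> gauss_ge w g \<Longrightarrow> gauss_ge w (f + g)"
  by (simp add: gauss_ge_def v_add_ge)

lemma gauss_ge_minus [simp]: "gauss_ge w (- f) \<longleftrightarrow> gauss_ge w f"
  by (simp add: gauss_ge_def)

lemma gauss_ge_diff: "gauss_ge w f \<Longrightarrow> gauss_ge w g \<Longrightarrow> gauss_ge w (f - g)"
  by (simp add: gauss_ge_def v_diff_ge)

lemma gauss_ge_diff_commute: "gauss_ge w (f - g) \<longleftrightarrow> gauss_ge w (g - f)"
  using gauss_ge_minus[of w "f - g"] by simp

text \<open>The thresholds \<open>(w - i) / m\<close> and \<open>(w' - (n - i)) / m\<close> add up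
  to \<open>(w + w' - n) / m\<close>, so every summand of the convolution meets the bound.\<close>

lemma gauss_ge_mult:
  assumes "gauss_ge w f" "gauss_ge w' g"
  shows "gauss_ge (w + w') (f * g)"
  unfolding gauss_ge_def
proof
  fix n
  have "ereal ((w + w' - real n) / m) \<le> v (f $ i * g $ (n - i))" if "i \<in> {0..n}" for i
  proof -
    have "(w + w' - real n) / m = (w - real i) / m + (w' - real (n - i)) / m"
      using that m_pos by (simp add: field_simps)
    then show ?thesis
      using assms unfolding gauss_ge_def by (metis v_mult_ge)
  qed
  then show "ereal ((w + w' - real n) / m) \<le> v ((f * g) $ n)"
    unfolding fps_mult_nth by (rule v_sum_ge)
qed

lemma gauss_ge_1: "w \<le> 0 \<Longrightarrow> gauss_ge w 1"
  using m_pos by (simp add: gauss_ge_def zero_ereal_def divide_nonpos_pos)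

lemma gauss_ge_cutoff: "gauss_ge w f \<Longrightarrow> gauss_ge w (fps_cutoff n f)"
  by (simp add: gauss_ge_def)

lemma gauss_ge_shift: "gauss_ge w f \<Longrightarrow> gauss_ge (w - real k) (fps_shift k f)"
  unfolding gauss_ge_def by (metis diff_diff_eq add.commute fps_shift_nth of_nat_add)

lemma gauss_ge_const_mult: "v c = 0 \<Longrightarrow> gauss_ge w f \<Longrightarrow> gauss_ge w (fps_const c * f)"
  by (simp add: gauss_ge_def v_mult)

lemma gauss_ge_monom: "v c = 0 \<Longrightarrow> gauss_ge (real k) (fps_const c * fps_X ^ k)"
  by (simp add: gauss_ge_def zero_ereal_def fps_X_power_nth)

lemma gauss_ge_all_imp_0: "(\<And>t. gauss_ge t f) \<Longrightarrow> f = 0"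
proof (rule fps_ext)
  fix i
  assume f: "\<And>t. gauss_ge t f"
  have "ereal t \<le> v (f $ i)" for t
  proof -
    have "(m * t + real i - real i) / m = t" using m_pos by simp
    then show ?thesis using f[of "m * t + real i"] unfolding gauss_ge_def by metis
  qed
  then show "f $ i = 0 $ i" using v_ge_all_imp_0 by simp
qed

lemma gauss_ge_limit_imp_0:
  assumes "0 < \<kappa>" "\<And>n. gauss_ge (w + real n * \<kappa>) f"
  shows "f = 0"
proof (rule gauss_ge_all_imp_0)
  fix t
  obtain n where "(t - w) / \<kappa> \<le> real n" using real_arch_simple by blast
  then show "gauss_ge t f"
    using assms(1) by (intro gauss_ge_mono[OF assms(2)[of n]]) (simp add: field_simps)
qed

lemma phi_nth: "2 \<le> p \<Longrightarrow> phi p f $ n = (if p dvd n then f $ (n div p) else 0)"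
proof -
  assume p: "2 \<le> p"
  have "phi p f $ n = (\<Sum>i=0..n. f $ i * (if n = p * i then 1 else 0))"
    by (simp add: phi_def fps_compose_nth fps_X_power_nth flip: power_mult)
  also have "\<dots> = (\<Sum>i=0..n. if p dvd n \<and> i = n div p then f $ i else 0)"
    using p by (intro sum.cong) auto
  also have "\<dots> = (if p dvd n then f $ (n div p) else 0)"
    by (auto simp: sum.delta)
  finally show ?thesis .
qed

text \<open>\<open>phi\<close> moves the coefficient of index \<open>i\<close> to index
  \<open>p * i\<close>, which raises its weight by \<open>(p - 1) * i\<close>. This is the source of
  the p - 1 in the final bound.\<close>

lemma gauss_ge_phi:
  assumes p: "2 \<le> p" and f: "gauss_ge w f" and ord: "\<And>i. i < k \<Longrightarrow> f $ i = 0"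
  shows "gauss_ge (w + (real p - 1) * real k) (phi p f)"
  unfolding gauss_ge_def
proof
  fix n
  show "ereal ((w + (real p - 1) * real k - real n) / m) \<le> v (phi p f $ n)"
  proof (cases "p dvd n \<and> k \<le> n div p")
    case True
    then obtain i where n: "n = p * i" by auto
    with p True have ki: "k \<le> i" by simp
    have "(real p - 1) * real k \<le> (real p - 1) * real i"
      using ki p by (intro mult_left_mono) auto
    then have "(w + (real p - 1) * real k - real n) / m \<le> (w - real i) / m"
      using m_pos by (intro divide_right_mono) (auto simp: n algebra_simps)
    also have "ereal \<dots> \<le> v (f $ i)"
      using f unfolding gauss_ge_def by blast
    finally show ?thesis
      using p by (simp add: phi_nth n)
  next
    case False
    then show ?thesis using p ord by (auto simp: phi_nth)
  qed
qed

text \<open>All but finitely many coefficients satisfy the bound for weight 0; the remaining ones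
  are met by taking a minimum.\<close>

lemma R_ring_lower_bound:
  assumes "f \<in> R_ring v m"
  obtains w where "gauss_ge w f"
proof -
  obtain n where n: "\<And>i. i \<ge> n \<Longrightarrow> ereal ((0 - real i) / m) \<le> v (f $ i)"
    using assms unfolding R_ring_iff eventually_sequentially by blast
  have "\<exists>t. \<forall>i<n. ereal ((t - real i) / m) \<le> v (f $ i)"
  proof (induction n)
    case (Suc n)
    then obtain t where t: "\<And>i. i < n \<Longrightarrow> ereal ((t - real i) / m) \<le> v (f $ i)" by blast
    obtain s where s: "ereal s \<le> v (f $ n)" by (rule v_lower_bound)
    have "ereal ((min t (m * s) - real i) / m) \<le> v (f $ i)" if "i < Suc n" for i
    proof (cases "i = n")
      case True
      have "(min t (m * s) - real n) / m \<le> s"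
        using m_pos by (simp add: field_simps)
      then show ?thesis using True s by (metis ereal_less_eq(3) order_trans)
    next
      case False
      have "(min t (m * s) - real i) / m \<le> (t - real i) / m"
        using m_pos by (simp add: divide_right_mono)
      then show ?thesis using False t[of i] that by (metis ereal_less_eq(3) order_trans less_antisym)
    qed
    then show ?case by blast
  qed auto
  then obtain t where t: "\<And>i. i < n \<Longrightarrow> ereal ((t - real i) / m) \<le> v (f $ i)" by blast
  have "ereal ((min t 0 - real i) / m) \<le> v (f $ i)" for i
  proof -
    have "(min t 0 - real i) / m \<le> (t - real i) / m" "(min t 0 - real i) / m \<le> (0 - real i) / m"
      using m_pos by (intro divide_right_mono; simp)+
    then show ?thesis using t[of i] n[of i] by (meson ereal_less_eq(3) order_trans not_le)
  qed
  then show ?thesis using that unfolding gauss_ge_def by blast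
qed

section \<open>\<open>R\<close> as a ring, stable under shifts and \<open>phi\<close>\<close>

lemma R_ring_finite_support: "(\<And>i. i \<ge> n \<Longrightarrow> f $ i = 0) \<Longrightarrow> f \<in> R_ring v m"
  unfolding R_ring_iff by (auto intro!: eventually_sequentiallyI[of n])

lemma R_ring_0: "0 \<in> R_ring v m" and R_ring_1: "1 \<in> R_ring v m"
  and R_ring_monom: "fps_const c * fps_X ^ k \<in> R_ring v m"
  and R_ring_const: "fps_const c \<in> R_ring v m"
  and R_ring_cutoff: "fps_cutoff n f \<in> R_ring v m"
  by (auto intro: R_ring_finite_support[of 1] R_ring_finite_support[of "Suc k"]
      R_ring_finite_support[of n])

lemma R_ring_add: "f \<in> R_ring v m \<Longrightarrow> g \<in> R_ring v m \<Longrightarrow> f + g \<in> R_ring v m"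
  unfolding R_ring_iff
proof
  fix w
  assume "\<forall>w. \<forall>\<^sub>F i in sequentially. ereal ((w - real i) / m) \<le> v (f $ i)"
    "\<forall>w. \<forall>\<^sub>F i in sequentially. ereal ((w - real i) / m) \<le> v (g $ i)"
  then have "\<forall>\<^sub>F i in sequentially. ereal ((w - real i) / m) \<le> v (f $ i)"
    "\<forall>\<^sub>F i in sequentially. ereal ((w - real i) / m) \<le> v (g $ i)" by blast+
  then show "\<forall>\<^sub>F i in sequentially. ereal ((w - real i) / m) \<le> v ((f + g) $ i)"
    by eventually_elim (simp add: v_add_ge)
qed

lemma R_ring_minus: "f \<in> R_ring v m \<Longrightarrow> - f \<in> R_ring v m"
  unfolding R_ring_iff by simp

lemma R_ring_diff: "f \<in> R_ring v m \<Longrightarrow> g \<in> R_ring v m \<Longrightarrow> f - g \<in> R_ring v m"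
  using R_ring_add[OF _ R_ring_minus] by fastforce

text \<open>For \<open>n \<ge> k + l\<close> each summand has \<open>i \<ge> k\<close> or
  \<open>n - i \<ge> l\<close>: one factor lies in the small tail, the other obeys its global
  bound.\<close>

lemma R_ring_mult:
  assumes f: "f \<in> R_ring v m" and g: "g \<in> R_ring v m"
  shows "f * g \<in> R_ring v m"
  unfolding R_ring_iff
proof
  fix w
  obtain s where s: "gauss_ge s f" using R_ring_lower_bound[OF f] .
  obtain t where t: "gauss_ge t g" using R_ring_lower_bound[OF g] .
  obtain k where k: "\<And>i. i \<ge> k \<Longrightarrow> ereal ((w - t - real i) / m) \<le> v (f $ i)"
    using f unfolding R_ring_iff eventually_sequentially by blast
  obtain l where l: "\<And>i. i \<ge> l \<Longrightarrow> ereal ((w - s - real i) / m) \<le> v (g $ i)"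
    using g unfolding R_ring_iff eventually_sequentially by blast
  show "\<forall>\<^sub>F n in sequentially. ereal ((w - real n) / m) \<le> v ((f * g) $ n)"
  proof (rule eventually_sequentiallyI[of "k + l"])
    fix n assume n: "k + l \<le> n"
    have "ereal ((w - real n) / m) \<le> v (f $ i * g $ (n - i))" if "i \<in> {0..n}" for i
    proof (cases "k \<le> i")
      case True
      have "(w - real n) / m = (w - t - real i) / m + (t - real (n - i)) / m"
        using that m_pos by (simp add: field_simps)
      then show ?thesis
        using k[OF True] t unfolding gauss_ge_def by (metis v_mult_ge)
    next
      case False
      then have "l \<le> n - i" using n by simp
      have "(w - real n) / m = (s - real i) / m + (w - s - real (n - i)) / m"
        using that m_pos by (simp add: field_simps)
      then show ?thesis
        using l[OF \<open>l \<le> n - i\<close>] s unfolding gauss_ge_def by (metis v_mult_ge)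
    qed
    then show "ereal ((w - real n) / m) \<le> v ((f * g) $ n)"
      unfolding fps_mult_nth by (rule v_sum_ge)
  qed
qed

lemma R_ring_shift: "f \<in> R_ring v m \<Longrightarrow> fps_shift k f \<in> R_ring v m"
  unfolding R_ring_iff
proof
  fix w
  assume "\<forall>w. \<forall>\<^sub>F i in sequentially. ereal ((w - real i) / m) \<le> v (f $ i)"
  then have "\<forall>\<^sub>F i in sequentially. ereal ((w + real k - real (i + k)) / m) \<le> v (f $ (i + k))"
    using eventually_sequentially_seg[of "\<lambda>i. ereal ((w + real k - real i) / m) \<le> v (f $ i)" k]
    by blast
  then show "\<forall>\<^sub>F i in sequentially. ereal ((w - real i) / m) \<le> v (fps_shift k f $ i)"
    by simp
qed

lemma R_ring_phi:
  assumes p: "2 \<le> p" and f: "f \<in> R_ring v m"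
  shows "phi p f \<in> R_ring v m"
  unfolding R_ring_iff
proof
  fix w
  obtain k where k: "\<And>i. i \<ge> k \<Longrightarrow> ereal ((w - real i) / m) \<le> v (f $ i)"
    using f unfolding R_ring_iff eventually_sequentially by blast
  show "\<forall>\<^sub>F n in sequentially. ereal ((w - real n) / m) \<le> v (phi p f $ n)"
  proof (rule eventually_sequentiallyI[of "p * k"])
    fix n assume n: "p * k \<le> n"
    show "ereal ((w - real n) / m) \<le> v (phi p f $ n)"
    proof (cases "p dvd n")
      case True
      then obtain i where i: "n = p * i" by auto
      have "(w - real n) / m \<le> (w - real i) / m"
        using p m_pos mult_right_mono[of 1 "real p" "real i"]
        by (intro divide_right_mono) (auto simp: i)
      also have "ereal \<dots> \<le> v (f $ i)"
        using k n p by (simp add: i)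
      finally show ?thesis using p by (simp add: phi_nth i)
    qed (use p in \<open>simp add: phi_nth\<close>)
  qed
qed

section \<open>Approximation, inverses and limits in \<open>R\<close>\<close>

lemma R_ring_approx:
  assumes "\<And>w. \<exists>q\<in>R_ring v m. gauss_ge w (f - q)"
  shows "f \<in> R_ring v m"
  unfolding R_ring_iff
proof
  fix w
  \<comment> \<open>From some index on, the coefficients of \<open>q\<close> meet the bound for
    weight \<open>w\<close>, and those of \<open>f - q\<close> meet it everywhere; hence
    \<open>R\<close> is closed for the Gauss valuation.\<close>
  obtain q where q: "q \<in> R_ring v m" "gauss_ge w (f - q)" using assms by blast
  have "\<forall>\<^sub>F i in sequentially. ereal ((w - real i) / m) \<le> v (q $ i)"
    using q(1) unfolding R_ring_iff by blast
  then show "\<forall>\<^sub>F i in sequentially. ereal ((w - real i) / m) \<le> v (f $ i)"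
  proof eventually_elim
    case (elim i)
    then show ?case
      using q(2) v_add_ge[of "ereal ((w - real i) / m)" "(f - q) $ i" "q $ i"]
      by (simp add: gauss_ge_def)
  qed
qed

text \<open>Since \<open>f\<close> has no constant term, \<open>g = 1 - f * g\<close> expresses each
  coefficient of \<open>g\<close> through earlier ones, and the bound propagates by strong
  induction.\<close>

lemma gauss_ge_inverse:
  assumes f0: "f $ 0 = 0" and f: "gauss_ge 0 f"
  shows "gauss_ge 0 (inverse (1 + f))"
proof -
  define g where "g = inverse (1 + f)"
  have "(1 + f) * g = 1"
    unfolding g_def using f0 by (intro inverse_mult_eq_1') simp
  then have g: "g = 1 - f * g" by (simp add: algebra_simps)
  have "ereal ((0 - real n) / m) \<le> v (g $ n)" for n
  proof (induction n rule: less_induct)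
    case (less n)
    have "ereal ((0 - real n) / m) \<le> v (f $ i * g $ (n - i))" if "i \<in> {0..n}" for i
    proof (cases "i = 0")
      case False
      with that have "n - i < n" by auto
      moreover have "(0 - real n) / m = (0 - real i) / m + (0 - real (n - i)) / m"
        using that m_pos by (simp add: field_simps)
      ultimately show ?thesis
        using f less unfolding gauss_ge_def by (metis v_mult_ge)
    qed (simp add: f0)
    then have "ereal ((0 - real n) / m) \<le> v ((f * g) $ n)"
      unfolding fps_mult_nth by (rule v_sum_ge)
    moreover have "ereal ((0 - real n) / m) \<le> v (1 $ n)"
      using gauss_ge_1[of 0] unfolding gauss_ge_def by blast
    ultimately have "ereal ((0 - real n) / m) \<le> v ((1 - f * g) $ n)"
      by (simp add: v_diff_ge)
    then show ?case using g by metis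
  qed
  then show ?thesis unfolding gauss_ge_def g_def by blast
qed

text \<open>Geometric series: the partial sums arise from 0 by replacing \<open>q\<close> with
  \<open>1 - f * q\<close>, and each round multiplies the distance from the inverse by
  \<open>- f\<close>, a gain of \<open>c\<close>. Closedness of \<open>R\<close> concludes.\<close>

lemma R_ring_inverse:
  assumes f: "f \<in> R_ring v m" and f0: "f $ 0 = 0" and c: "0 < c" and fc: "gauss_ge c f"
  shows "inverse (1 + f) \<in> R_ring v m"
proof (rule R_ring_approx)
  fix w
  define g where "g = inverse (1 + f)"
  have "(1 + f) * g = 1"
    unfolding g_def using f0 by (intro inverse_mult_eq_1') simp
  then have g: "g = 1 - f * g" by (simp add: algebra_simps)
  have "\<exists>q\<in>R_ring v m. gauss_ge (real n * c) (g - q)" for n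
  proof (induction n)
    case 0
    have "gauss_ge 0 g"
      unfolding g_def using gauss_ge_inverse[OF f0 gauss_ge_mono[OF fc]] c by simp
    then show ?case using R_ring_0 by (intro bexI[of _ 0]) auto
  next
    case (Suc n)
    then obtain q where q: "q \<in> R_ring v m" "gauss_ge (real n * c) (g - q)" by blast
    have "g - (1 - f * q) = - (f * (g - q))"
      by (subst (1) g) (simp add: right_diff_distrib)
    moreover have "gauss_ge (c + real n * c) (f * (g - q))"
      by (rule gauss_ge_mult[OF fc q(2)])
    moreover have "real (Suc n) * c = c + real n * c"
      by (simp add: distrib_right)
    ultimately have "gauss_ge (real (Suc n) * c) (g - (1 - f * q))"
      by (metis gauss_ge_minus)
    then show ?case
      using R_ring_diff[OF R_ring_1 R_ring_mult[OF f q(1)]] by blast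
  qed
  moreover obtain n where "w / c \<le> real n" using real_arch_simple by blast
  then have "w \<le> real n * c" using c by (simp add: field_simps)
  ultimately show "\<exists>q\<in>R_ring v m. gauss_ge w (inverse (1 + f) - q)"
    unfolding g_def[symmetric] using gauss_ge_mono by blast
qed

lemma gauss_ge_telescope:
  assumes \<kappa>: "0 \<le> \<kappa>" and step: "\<And>n. gauss_ge (w + real n * \<kappa>) (S (Suc n) - S n)" and "n \<le> k"
  shows "gauss_ge (w + real n * \<kappa>) (S k - S n)"
  using \<open>n \<le> k\<close>
proof (induction k rule: dec_induct)
  case (step k)
  have "real n * \<kappa> \<le> real k * \<kappa>"
    using step \<kappa> by (intro mult_right_mono) auto
  then have "gauss_ge (w + real n * \<kappa>) (S (Suc k) - S k)"
    by (intro gauss_ge_mono[OF assms(2)[of k]]) simp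
  from gauss_ge_add[OF this step.IH] show ?case by simp
qed simp

end

locale complete_gauss_valued_field = gauss_valued_field +
  assumes complete: "val_Cauchy v X \<Longrightarrow> \<exists>l. val_limit v X l"
begin

text \<open>Coefficientwise limits exist in the complete field. The bounds are uniform, so they pass
  to the limit series, and closedness puts it in \<open>R\<close>.\<close>

lemma R_ring_complete:
  assumes \<kappa>: "0 < \<kappa>" and step: "\<And>n. gauss_ge (w + real n * \<kappa>) (S (Suc n) - S n)"
    and S: "\<And>n. S n \<in> R_ring v m"
  obtains f where "f \<in> R_ring v m" "\<And>n. gauss_ge (w + real n * \<kappa>) (f - S n)"
proof -
  have tele: "gauss_ge (w + real n * \<kappa>) (S k - S n)" if "n \<le> k" for n k
    using gauss_ge_telescope[OF _ step that] \<kappa> by simp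
  have index: "\<exists>n. t \<le> w + real n * \<kappa>" for t
  proof -
    obtain n where "(t - w) / \<kappa> \<le> real n" using real_arch_simple by blast
    then have "t \<le> w + real n * \<kappa>" using \<kappa> by (simp add: field_simps)
    then show ?thesis by blast
  qed
  have "\<exists>l. val_limit v (\<lambda>k. S k $ i) l" for i
  proof (rule complete, unfold val_Cauchy_def, intro allI)
    fix t :: real
    obtain n where n: "m * t + real i \<le> w + real n * \<kappa>" using index by blast
    have "ereal t \<le> v (S k $ i - S n $ i)" if "n \<le> k" for k
    proof -
      have "t \<le> (w + real n * \<kappa> - real i) / m" using n m_pos by (simp add: field_simps)
      moreover have "ereal ((w + real n * \<kappa> - real i) / m) \<le> v (S k $ i - S n $ i)"
        using tele[OF that] unfolding gauss_ge_def by auto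
      ultimately show ?thesis by (metis ereal_less_eq(3) order_trans)
    qed
    then have "ereal t \<le> v (S k $ i - S l $ i)" if "n \<le> k" "n \<le> l" for k l
      using v_diff_ge[of "ereal t" "S k $ i - S n $ i" "S l $ i - S n $ i"] that by simp
    then show "\<exists>M. \<forall>k\<ge>M. \<forall>l\<ge>M. ereal t \<le> v (S k $ i - S l $ i)" by blast
  qed
  then obtain L where L: "\<And>i. val_limit v (\<lambda>k. S k $ i) (L i)" by metis
  define f where "f = Abs_fps L"
  have f: "gauss_ge (w + real n * \<kappa>) (f - S n)" for n
    unfolding gauss_ge_def
  proof
    fix i
    let ?t = "(w + real n * \<kappa> - real i) / m"
    \<comment> \<open>\<open>k0\<close> depends on \<open>i\<close>, but the resulting bound on the
      coefficient of \<open>f - S n\<close> does not involve it.\<close>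
    obtain k0 where k0: "\<And>k. k0 \<le> k \<Longrightarrow> ereal ?t \<le> v (S k $ i - L i)"
      using L[of i] unfolding val_limit_iff eventually_sequentially by blast
    let ?k = "max k0 n"
    have "ereal ?t \<le> v ((S ?k - S n) $ i)"
      using tele[of n ?k] unfolding gauss_ge_def by simp
    then show "ereal ?t \<le> v ((f - S n) $ i)"
      using v_diff_ge[of "ereal ?t" "(S ?k - S n) $ i" "S ?k $ i - L i"] k0[of ?k]
      by (simp add: f_def)
  qed
  have "f \<in> R_ring v m"
  proof (rule R_ring_approx)
    fix t
    obtain n where "t \<le> w + real n * \<kappa>" using index by blast
    then show "\<exists>q\<in>R_ring v m. gauss_ge t (f - q)"
      using S f gauss_ge_mono by blast
  qed
  then show ?thesis using f that by blast
qed

end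

unbundle no fps_syntax and vec_syntax


section \<open>Two-by-two matrices over the ring of convergent series\<close>

lemma mat2_nth [simp]: "mat2 x y z w $ 1 $ 1 = x" "mat2 x y z w $ 1 $ 2 = y"
  "mat2 x y z w $ 2 $ 1 = z" "mat2 x y z w $ 2 $ 2 = w"
  by (simp_all add: mat2_def)

lemma matrix_eq_2: "A = B \<longleftrightarrow> A $ 1 $ 1 = B $ 1 $ 1 \<and> A $ 1 $ 2 = B $ 1 $ 2 \<and>
    A $ 2 $ 1 = B $ 2 $ 1 \<and> A $ 2 $ 2 = B $ 2 $ 2" for A B :: "'a^2^2"
  by (simp add: vec_eq_iff forall_2)

lemma matrix_mult_2: "(A ** B) $ i $ j = A $ i $ 1 * B $ 1 $ j + A $ i $ 2 * B $ 2 $ j"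
  for A B :: "'a::semiring_1^2^2"
  by (simp add: matrix_matrix_mult_def sum_2)

lemma matrix_add_rdistrib_2: "(A + B) ** C = A ** C + B ** C" for A B C :: "'a::semiring_1^2^2"
  by (simp add: matrix_eq_2 matrix_mult_2 algebra_simps)

lemma mat_1_nth_2 [simp]: "(mat 1 :: 'a::zero_neq_one^2^2) $ 1 $ 1 = 1"
  "(mat 1 :: 'a^2^2) $ 1 $ 2 = 0" "(mat 1 :: 'a^2^2) $ 2 $ 1 = 0" "(mat 1 :: 'a^2^2) $ 2 $ 2 = 1"
  by (simp_all add: mat_def)

section \<open>The endomorphism \<open>phi\<close> on series and matrices\<close>

lemma phi_add: "phi p (f + g) = phi p f + phi p g"
  and phi_diff: "phi p (f - g) = phi p f - phi p g"
  and phi_0 [simp]: "phi p 0 = 0" and phi_1 [simp]: "phi p 1 = 1"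
  and phi_mult: "0 < p \<Longrightarrow> phi p (f * g) = phi p f * phi p g"
  for f g :: "'f::field fps"
  by (simp_all add: phi_def fps_compose_add_distrib fps_compose_sub_distrib
      fps_compose_mult_distrib fps_X_power_nth)

lemma map_matrix_phi_mult:
  "0 < p \<Longrightarrow> map_matrix (phi p) (A ** B) = map_matrix (phi p) A ** map_matrix (phi p) B"
  for A B :: "'f::field fps^2^2"
  by (simp add: matrix_eq_2 matrix_mult_2 phi_add phi_mult)

lemma map_matrix_phi_mat_1 [simp]: "map_matrix (phi p) (mat 1 :: 'f::field fps^2^2) = mat 1"
  by (simp add: matrix_eq_2)

context gauss_valued_field
begin

lemma H_iff: "f \<in> H v m (ereal w) \<longleftrightarrow> f \<in> R_ring v m \<and> gauss_ge w f"
  by (simp add: H_def gauss_ge_iff)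

text \<open>Stated for an extended real \<open>w\<close>, because the error, and with it the radius
  \<open>r\<close>, is infinite when \<open>C = T C\<close>.\<close>

lemma zero_in_H: "0 \<in> H v m w"
proof -
  have "ereal t \<le> v_R v m 0" for t
    using gauss_ge_iff[of t 0] by simp
  then have "v_R v m 0 = \<infinity>" using ereal_top by blast
  then show ?thesis by (simp add: H_def R_ring_0)
qed

lemma M2_R_iff: "A \<in> M2_R v m \<longleftrightarrow> A $ 1 $ 1 \<in> R_ring v m \<and> A $ 1 $ 2 \<in> R_ring v m \<and>
    A $ 2 $ 1 \<in> R_ring v m \<and> A $ 2 $ 2 \<in> R_ring v m"
  by (auto simp: M2_R_def forall_2)

lemma M2_R_add: "A \<in> M2_R v m \<Longrightarrow> B \<in> M2_R v m \<Longrightarrow> A + B \<in> M2_R v m"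
  and M2_R_diff: "A \<in> M2_R v m \<Longrightarrow> B \<in> M2_R v m \<Longrightarrow> A - B \<in> M2_R v m"
  and M2_R_mult: "A \<in> M2_R v m \<Longrightarrow> B \<in> M2_R v m \<Longrightarrow> A ** B \<in> M2_R v m"
  and M2_R_phi: "2 \<le> p \<Longrightarrow> A \<in> M2_R v m \<Longrightarrow> map_matrix (phi p) A \<in> M2_R v m"
  by (simp_all add: M2_R_iff matrix_mult_2 R_ring_add R_ring_diff R_ring_mult R_ring_phi)

lemmas R_ring_intros = R_ring_1 R_ring_add R_ring_minus R_ring_diff R_ring_mult
  R_ring_const R_ring_cutoff R_ring_shift

lemma GL2_R_mat_1: "mat 1 \<in> GL2_R v m"
  by (auto simp: GL2_R_def M2_R_iff R_ring_0 R_ring_1 intro!: bexI[of _ "mat 1"])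

text \<open>Replaces twisted conjugation by an equation without inverses; \<open>phi\<close> is a
  ring homomorphism, so it carries an inverse of \<open>A\<close> to an inverse of the image of
  \<open>A\<close>.\<close>

lemma phi_conj_eqI:
  assumes p: "0 < p" and A: "A \<in> GL2_R v m" and eq: "A ** C = C' ** map_matrix (phi p) A"
  shows "phi_conj p A C = C'"
proof -
  let ?A = "map_matrix (phi p) A"
  obtain B where B: "A ** B = mat 1" "B ** A = mat 1"
    using A unfolding GL2_R_def by blast
  have "?A ** map_matrix (phi p) B = mat 1" "map_matrix (phi p) B ** ?A = mat 1"
    using B by (simp_all add: p flip: map_matrix_phi_mult)
  \<comment> \<open>\<open>matrix_inv\<close> is a choice operator, so a two-sided inverse has to be
    exhibited first.\<close>
  then have "?A ** matrix_inv ?A = mat 1"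
    unfolding matrix_inv_def by (metis (mono_tags, lifting) someI_ex)
  then have "C' ** ?A ** matrix_inv ?A = C'"
    by (simp add: flip: matrix_mul_assoc)
  then show ?thesis by (simp add: phi_conj_def eq)
qed

text \<open>Neither \<open>X\<close> nor its image under \<open>phi\<close> has constant terms, so
  at u = 0 the two sides reduce to \<open>C\<close> and \<open>C'\<close>.\<close>

lemma mod_u_phi_conj:
  assumes p: "0 < p" and X: "\<And>i j. fps_nth (X $ i $ j) 0 = 0"
    and eq: "(mat 1 + X) ** C = C' ** map_matrix (phi p) (mat 1 + X)"
  shows "mod_u C = mod_u C'"
proof -
  have X': "fps_nth (phi p (X $ i $ j)) 0 = 0" for i j
    using X by (simp add: phi_def)
  have "fps_nth (((mat 1 + X) ** C) $ i $ j) 0 =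
      fps_nth ((C' ** map_matrix (phi p) (mat 1 + X)) $ i $ j) 0" for i j
    using eq by simp
  from this[of 1 1] this[of 1 2] this[of 2 1] this[of 2 2] show ?thesis
    by (simp add: mod_u_def matrix_eq_2 matrix_mult_2 phi_add X X')
qed

text \<open>The determinant is \<open>1 + d\<close> with \<open>d\<close> of positive Gauss
  valuation and no constant term, hence a unit of \<open>R\<close>; the inverse is the adjugate
  divided by it. The off-diagonal entries enter \<open>d\<close> only through their product, so one
  of \<open>s\<close>, \<open>t\<close> may be negative.\<close>

lemma GL2_R_mat_1_plus:
  assumes X: "X \<in> M2_R v m" and X0: "\<And>i j. fps_nth (X $ i $ j) 0 = 0" and c: "0 < c" "c \<le> s + t"
    and ge: "gauss_ge c (X $ 1 $ 1)" "gauss_ge s (X $ 1 $ 2)"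
      "gauss_ge t (X $ 2 $ 1)" "gauss_ge c (X $ 2 $ 2)"
  shows "mat 1 + X \<in> GL2_R v m"
proof -
  define d where "d = X $ 1 $ 1 + X $ 2 $ 2 + X $ 1 $ 1 * X $ 2 $ 2 - X $ 1 $ 2 * X $ 2 $ 1"
  define e where "e = inverse (1 + d)"
  have XR: "X $ 1 $ 1 \<in> R_ring v m" "X $ 1 $ 2 \<in> R_ring v m" "X $ 2 $ 1 \<in> R_ring v m"
    "X $ 2 $ 2 \<in> R_ring v m"
    using X by (auto simp: M2_R_iff)
  have d0: "fps_nth d 0 = 0"
    by (simp add: d_def X0)
  have "gauss_ge c d"
    unfolding d_def using c
    by (intro gauss_ge_add gauss_ge_diff ge gauss_ge_mono[OF gauss_ge_mult[OF ge(1,4)]]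
        gauss_ge_mono[OF gauss_ge_mult[OF ge(2,3)]]) auto
  moreover have "d \<in> R_ring v m"
    unfolding d_def by (intro R_ring_intros XR)
  ultimately have e: "e \<in> R_ring v m"
    unfolding e_def using R_ring_inverse d0 c by blast
  have "(1 + d) * e = 1"
    unfolding e_def using d0 by (intro inverse_mult_eq_1') simp
  then have de: "e + (X $ 1 $ 1 + X $ 2 $ 2 + X $ 1 $ 1 * X $ 2 $ 2 - X $ 1 $ 2 * X $ 2 $ 1) * e = 1"
    by (simp add: d_def distrib_right)
  define B where "B = mat2 (e * (1 + X $ 2 $ 2)) (- (e * X $ 1 $ 2)) (- (e * X $ 2 $ 1))
    (e * (1 + X $ 1 $ 1))"
  have "(mat 1 + X) ** B = mat 1" "B ** (mat 1 + X) = mat 1"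
    using de by (simp_all add: matrix_eq_2 matrix_mult_2 B_def algebra_simps)
  moreover have "B \<in> M2_R v m" "mat 1 + X \<in> M2_R v m"
    unfolding M2_R_iff B_def using e XR by (auto intro!: R_ring_intros)
  ultimately show ?thesis unfolding GL2_R_def by blast
qed

section \<open>Division of a tail by a monomial\<close>

definition tail_quot :: "nat \<Rightarrow> nat \<Rightarrow> 'f \<Rightarrow> 'f fps \<Rightarrow> 'f fps" where
  "tail_quot n k c f = fps_const (inverse c) * fps_shift k (f - trunc_le n f)"

lemma tail_quot_diff: "tail_quot n k c (f - g) = tail_quot n k c f - tail_quot n k c g"
  by (simp add: tail_quot_def trunc_le_def fps_eq_iff algebra_simps)

text \<open>The tail starts in degree \<open>n + 1\<close>, so its quotient by \<open>u^k\<close>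
  starts in degree \<open>n + 1 - k\<close>. This vanishing is what \<open>phi\<close> turns into a
  gain.\<close>

lemma tail_quot_nth: "i + k \<le> n \<Longrightarrow> fps_nth (tail_quot n k c f) i = 0"
  by (simp add: tail_quot_def trunc_le_def)

text \<open>For \<open>k \<le> n\<close> the shift discards only zero coefficients, so the division
  by \<open>c u^k\<close> is exact.\<close>

lemma monom_mult_tail_quot:
  "k \<le> n \<Longrightarrow> c \<noteq> 0 \<Longrightarrow> fps_const c * fps_X ^ k * tail_quot n k c f = f - trunc_le n f"
proof -
  assume "k \<le> n" "c \<noteq> 0"
  have "fps_const c * fps_X ^ k * tail_quot n k c f = fps_X ^ k * fps_shift k (f - trunc_le n f)"
    using \<open>c \<noteq> 0\<close> unfolding tail_quot_def
    by (simp add: fps_eq_iff mult.assoc fps_X_power_mult_nth)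
  also have "\<dots> = f - trunc_le n f"
    using \<open>k \<le> n\<close> by (simp add: fps_eq_iff fps_X_power_mult_nth trunc_le_def)
  finally show ?thesis .
qed

lemma gauss_ge_trunc_le: "gauss_ge w f \<Longrightarrow> gauss_ge w (trunc_le n f)"
  by (simp add: trunc_le_def gauss_ge_cutoff)

lemma gauss_ge_tail_quot:
  assumes "v c = 0" "gauss_ge (w + real k) f"
  shows "gauss_ge w (tail_quot n k c f)"
proof -
  have "c \<noteq> 0" using assms(1) by auto
  then have "v (inverse c) = 0"
    using v_inverse[of c 0] assms(1) by (simp add: zero_ereal_def)
  then show ?thesis
    unfolding tail_quot_def using assms(2) gauss_ge_shift[of "w + real k" _ k]
    by (intro gauss_ge_const_mult) (auto intro!: gauss_ge_diff gauss_ge_trunc_le)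
qed

lemma R_ring_tail_quot: "f \<in> R_ring v m \<Longrightarrow> tail_quot n k c f \<in> R_ring v m"
  unfolding tail_quot_def trunc_le_def by (intro R_ring_intros)

lemma gauss_ge_mult_le: "gauss_ge s f \<Longrightarrow> gauss_ge t g \<Longrightarrow> w \<le> s + t \<Longrightarrow> gauss_ge w (f * g)"
  using gauss_ge_mult gauss_ge_mono by blast

end


section \<open>The fixed point equation\<close>

text \<open>The matrix \<open>C\<close> of the theorem is \<open>C0 + D\<close>, and \<open>trunc D\<close> is \<open>T(C) - C0\<close>.\<close>

locale allowable_matrix = complete_gauss_valued_field v m
  for v :: "'f::field \<Rightarrow> ereal" and m +
  fixes p a b N :: nat and a' b' \<gamma> \<epsilon> :: real and ca cb :: 'f and D :: "'f fps^2^2"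
  assumes p: "2 \<le> p" and ab: "real a + real b = a' + b'" and a'_le_b': "a' \<le> b'"
    and N: "b \<le> N" "b' - a' \<le> (real p - 1) * real (N + 1 - b)"
    and ca: "v ca = 0" and cb: "v cb = 0" and \<gamma>: "0 < \<gamma>" "\<gamma> \<le> \<epsilon>"
    and D_R: "D \<in> M2_R v m"
    and D_ge: "gauss_ge (a' + \<gamma>) (D $ 1 $ 1)" "gauss_ge (real a + \<gamma>) (D $ 1 $ 2)"
      "gauss_ge (real b + \<gamma>) (D $ 2 $ 1)" "gauss_ge (b' + \<gamma>) (D $ 2 $ 2)"
    and tail_ge: "gauss_ge (a' + \<epsilon>) (D $ 1 $ 1 - trunc_le N (D $ 1 $ 1))"
      "gauss_ge (real a + \<epsilon>) (D $ 1 $ 2 - trunc_le a (D $ 1 $ 2))"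
      "gauss_ge (real b + \<epsilon>) (D $ 2 $ 1 - trunc_le b (D $ 2 $ 1))"
      "gauss_ge (b' + \<epsilon>) (D $ 2 $ 2 - trunc_le a (D $ 2 $ 2))"
begin

text \<open>\<gamma> is what multiplication by \<open>D\<close> gains, and p - 1 is what
  \<open>phi\<close> gains on a series divisible by u.\<close>

definition \<mu> :: real where
  "\<mu> = min \<gamma> (real p - 1)"

lemma \<mu>: "0 < \<mu>" "\<mu> \<le> \<gamma>" "\<mu> \<le> \<epsilon>" "\<mu> \<le> real p - 1"
  using p \<gamma> by (auto simp: \<mu>_def)

definition C0 :: "'f fps^2^2" where
  "C0 = mat2 0 (fps_const ca * fps_X ^ a) (fps_const cb * fps_X ^ b) 0"

text \<open>The operator \<open>T\<close> with its bound \<open>N\<close> left as a parameter,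
  constrained only by the locale assumptions.\<close>

definition trunc :: "'f fps^2^2 \<Rightarrow> 'f fps^2^2" where
  "trunc M = mat2 (trunc_le N (M $ 1 $ 1)) (trunc_le a (M $ 1 $ 2))
                  (trunc_le b (M $ 2 $ 1)) (trunc_le a (M $ 2 $ 2))"

lemma trunc_nth [simp]: "trunc M $ 1 $ 1 = trunc_le N (M $ 1 $ 1)"
  "trunc M $ 1 $ 2 = trunc_le a (M $ 1 $ 2)" "trunc M $ 2 $ 1 = trunc_le b (M $ 2 $ 1)"
  "trunc M $ 2 $ 2 = trunc_le a (M $ 2 $ 2)"
  by (simp_all add: trunc_def)

text \<open>The matrix \<open>(M - trunc M) C0\<^sup>-\<^sup>1\<close>.\<close>

definition corr :: "'f fps^2^2 \<Rightarrow> 'f fps^2^2" where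
  "corr M = mat2 (tail_quot a a ca (M $ 1 $ 2)) (tail_quot N b cb (M $ 1 $ 1))
                 (tail_quot a a ca (M $ 2 $ 2)) (tail_quot b b cb (M $ 2 $ 1))"

abbreviation \<Phi> :: "'f fps^2^2 \<Rightarrow> 'f fps^2^2" where
  "\<Phi> \<equiv> map_matrix (phi p)"

text \<open>With \<open>X = corr Z\<close> and \<open>G\<close> in the place of
  \<open>C' - C0\<close>, these are the terms of \<open>(1 + X) (C0 + D) = C' (1 + \<Phi> X)\<close>
  that involve \<open>\<Phi> X\<close> or the product of \<open>X\<close> and \<open>D\<close>.
  Keeping \<open>G\<close> separate makes \<open>rem\<close> additive in \<open>Z\<close>.\<close>

definition rem :: "'f fps^2^2 \<Rightarrow> 'f fps^2^2 \<Rightarrow> 'f fps^2^2" where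
  "rem G Z = G ** \<Phi> (corr Z) + C0 ** \<Phi> (corr Z) - corr Z ** D"

text \<open>
  A fixed point \<open>M\<close> gives \<open>(1 + X) C = C' (1 + \<Phi> X)\<close> with \<open>X = corr M\<close> and
  \<open>C' = C0 + trunc D - trunc M\<close>.
\<close>

definition step :: "'f fps^2^2 \<Rightarrow> 'f fps^2^2" where
  "step M = rem (trunc D - trunc M) M - (D - trunc D)"

text \<open>
  The \<open>(2,2)\<close> entry is penalised by \<open>h\<close>: one step need not improve the contribution of the
  \<open>(1,1)\<close> entry to the \<open>(2,2)\<close> entry, but it improves that of \<open>(2,2)\<close> to \<open>(1,1)\<close>.
\<close>

definition weight_ge :: "real \<Rightarrow> real \<Rightarrow> 'f fps^2^2 \<Rightarrow> bool" where
  "weight_ge t h M \<longleftrightarrow> gauss_ge (a' + t) (M $ 1 $ 1) \<and> gauss_ge (real a + t) (M $ 1 $ 2) \<and>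
     gauss_ge (real b + t) (M $ 2 $ 1) \<and> gauss_ge (b' + t - h) (M $ 2 $ 2)"

section \<open>Weighted bounds for the correction and the remainder\<close>

lemma weight_ge_add: "weight_ge t h M \<Longrightarrow> weight_ge t h M' \<Longrightarrow> weight_ge t h (M + M')"
  and weight_ge_diff: "weight_ge t h M \<Longrightarrow> weight_ge t h M' \<Longrightarrow> weight_ge t h (M - M')"
  and weight_ge_trunc: "weight_ge t h M \<Longrightarrow> weight_ge t h (trunc M)"
  by (auto simp: weight_ge_def gauss_ge_add gauss_ge_diff gauss_ge_trunc_le)

lemma weight_ge_mono:
  "weight_ge t h M \<Longrightarrow> t' \<le> t \<Longrightarrow> t' - h' \<le> t - h \<Longrightarrow> weight_ge t' h' M"
  unfolding weight_ge_def by (auto elim!: gauss_ge_mono)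

lemma weight_ge_diff_commute: "weight_ge t h (M - M') \<longleftrightarrow> weight_ge t h (M' - M)"
  unfolding weight_ge_def vector_minus_component by (meson gauss_ge_diff_commute)

lemma weight_ge_D: "weight_ge \<gamma> 0 D" and weight_ge_tail: "weight_ge \<epsilon> 0 (D - trunc D)"
  using D_ge tail_ge by (simp_all add: weight_ge_def)

text \<open>Right division by the antidiagonal \<open>C0\<close> swaps the columns and costs
  \<open>a\<close> or \<open>b\<close>. The penalty \<open>h\<close> therefore lands in the (2,1)
  entry. The off-diagonal shifts \<open>a' - b\<close> and \<open>b' - a\<close> may be negative,
  but they cancel because \<open>a + b = a' + b'\<close>.\<close>

lemma corr_ge:
  assumes "weight_ge t h Z"
  shows "gauss_ge t (corr Z $ 1 $ 1)" "gauss_ge (t + a' - real b) (corr Z $ 1 $ 2)"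
    "gauss_ge (t - h + b' - real a) (corr Z $ 2 $ 1)" "gauss_ge t (corr Z $ 2 $ 2)"
  using assms unfolding corr_def weight_ge_def
  by (auto intro!: gauss_ge_tail_quot ca cb elim!: gauss_ge_mono)

lemma corr_nth_0: "fps_nth (corr Z $ i $ j) 0 = 0"
  using exhaust_2[of i] exhaust_2[of j] N(1) by (auto simp: corr_def tail_quot_nth)

text \<open>Three entries are known only to be divisible by u and gain p - 1. The (1,2) entry
  vanishes to order \<open>N + 1 - b\<close> and gains \<open>K\<close>, which the choice of
  \<open>N\<close> makes at least \<open>b' - a'\<close>.\<close>

lemma phi_corr_ge:
  assumes "weight_ge t h Z"
  defines "K \<equiv> (real p - 1) * real (N + 1 - b)"
  shows "gauss_ge (t + real p - 1) (\<Phi> (corr Z) $ 1 $ 1)"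
    "gauss_ge (t + a' - real b + K) (\<Phi> (corr Z) $ 1 $ 2)"
    "gauss_ge (t - h + b' - real a + real p - 1) (\<Phi> (corr Z) $ 2 $ 1)"
    "gauss_ge (t + real p - 1) (\<Phi> (corr Z) $ 2 $ 2)"
proof -
  have ord: "fps_nth (corr Z $ 1 $ 2) i = 0" if "i < N + 1 - b" for i
    using that N(1) by (simp add: corr_def tail_quot_nth)
  have ord1: "fps_nth (corr Z $ i $ j) k = 0" if "k < (1::nat)" for i j k
    using that corr_nth_0 by simp
  note ge = corr_ge[OF assms(1)]
  show "gauss_ge (t + a' - real b + K) (\<Phi> (corr Z) $ 1 $ 2)"
    unfolding K_def nth_map_matrix by (rule gauss_ge_phi[OF p ge(2) ord])
  show "gauss_ge (t + real p - 1) (\<Phi> (corr Z) $ 1 $ 1)"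
    "gauss_ge (t - h + b' - real a + real p - 1) (\<Phi> (corr Z) $ 2 $ 1)"
    "gauss_ge (t + real p - 1) (\<Phi> (corr Z) $ 2 $ 2)"
    using gauss_ge_phi[OF p ge(1), of 1] gauss_ge_phi[OF p ge(3), of 1]
      gauss_ge_phi[OF p ge(4), of 1] ord1
    by (simp_all add: algebra_simps)
qed

lemma K_ge: "real p - 1 \<le> (real p - 1) * real (N + 1 - b)"
  using N(1) p mult_left_mono[of 1 "real (N + 1 - b)" "real p - 1"] by simp

lemma C0_nth: "C0 $ 1 $ 1 = 0" "C0 $ 2 $ 2 = 0"
  "gauss_ge (real a) (C0 $ 1 $ 2)" "gauss_ge (real b) (C0 $ 2 $ 1)"
  using gauss_ge_monom ca cb by (simp_all add: C0_def)

text \<open>The penalty on \<open>Z\<close> costs at most \<open>h\<close> of the gain. The critical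
  term is in the (2,2) entry: \<open>c_b u^b\<close> times \<open>phi\<close> of the (1,2) entry of
  \<open>corr Z\<close> has only weight \<open>a' + t + K\<close>. Against \<open>b'\<close> this
  may be no gain, which produces the new penalty \<open>\<mu> - h\<close>; against \<open>a'\<close>
  it gains at least p - 1, which gives the second claim.\<close>

lemma rem_ge:
  assumes G: "weight_ge \<gamma> 0 G" and Z: "weight_ge t h Z" and h: "0 \<le> h" "h \<le> \<mu>"
  shows "weight_ge (t + \<mu> - h) (\<mu> - h) (rem G Z)"
    and "gauss_ge (a' + t + \<mu> - h) (rem G Z $ 2 $ 2)"
proof -
  note x = corr_ge[OF Z] and f = phi_corr_ge[OF Z]
  have g: "gauss_ge (a' + \<gamma>) (G $ 1 $ 1)" "gauss_ge (real a + \<gamma>) (G $ 1 $ 2)"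
    "gauss_ge (real b + \<gamma>) (G $ 2 $ 1)" "gauss_ge (b' + \<gamma>) (G $ 2 $ 2)"
    using G by (simp_all add: weight_ge_def)
  note ineqs = h \<mu> N(2) K_ge ab a'_le_b'
  \<comment> \<open>The diagonal entries of \<open>C0\<close> are zero, so \<open>gauss_ge_0\<close>
    may give them any weight; it is chosen to make the linear inequality hold, here and in the other
    entries.\<close>
  have 11: "gauss_ge (a' + (t + \<mu> - h)) (rem G Z $ 1 $ 1)"
    unfolding rem_def vector_add_component vector_minus_component matrix_mult_2 C0_nth(1)
    using ineqs
    by (intro gauss_ge_add gauss_ge_diff gauss_ge_mult_le[OF x(1) D_ge(1)]
        gauss_ge_mult_le[OF x(2) D_ge(3)] gauss_ge_mult_le[OF g(1) f(1)]
        gauss_ge_mult_le[OF g(2) f(3)] gauss_ge_mult_le[OF C0_nth(3) f(3)]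
        gauss_ge_mult_le[OF gauss_ge_0[of a'] f(1)]) linarith+
  have 12: "gauss_ge (real a + (t + \<mu> - h)) (rem G Z $ 1 $ 2)"
    unfolding rem_def vector_add_component vector_minus_component matrix_mult_2 C0_nth(1)
    using ineqs
    by (intro gauss_ge_add gauss_ge_diff gauss_ge_mult_le[OF x(1) D_ge(2)]
        gauss_ge_mult_le[OF x(2) D_ge(4)] gauss_ge_mult_le[OF g(1) f(2)]
        gauss_ge_mult_le[OF g(2) f(4)] gauss_ge_mult_le[OF C0_nth(3) f(4)]
        gauss_ge_mult_le[OF gauss_ge_0[of "a' + \<gamma>"] f(2)]) linarith+
  have 21: "gauss_ge (real b + (t + \<mu> - h)) (rem G Z $ 2 $ 1)"
    unfolding rem_def vector_add_component vector_minus_component matrix_mult_2 C0_nth(2)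
    using ineqs
    by (intro gauss_ge_add gauss_ge_diff gauss_ge_mult_le[OF x(3) D_ge(1)]
        gauss_ge_mult_le[OF x(4) D_ge(3)] gauss_ge_mult_le[OF g(3) f(1)]
        gauss_ge_mult_le[OF g(4) f(3)] gauss_ge_mult_le[OF C0_nth(4) f(1)]
        gauss_ge_mult_le[OF gauss_ge_0[of b'] f(3)]) linarith+
  \<comment> \<open>Both claims use this entry, with \<open>w\<close> measured from
    \<open>b'\<close> and from \<open>a'\<close> respectively; the second premise is the weight of
    the critical term.\<close>
  have 22: "gauss_ge w (rem G Z $ 2 $ 2)"
    if "w \<le> b' + t + \<mu> - h" "w \<le> a' + t + (real p - 1) * real (N + 1 - b)" for w
    unfolding rem_def vector_add_component vector_minus_component matrix_mult_2 C0_nth(2)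
    using ineqs that
    by (intro gauss_ge_add gauss_ge_diff gauss_ge_mult_le[OF x(3) D_ge(2)]
        gauss_ge_mult_le[OF x(4) D_ge(4)] gauss_ge_mult_le[OF g(3) f(2)]
        gauss_ge_mult_le[OF g(4) f(4)] gauss_ge_mult_le[OF C0_nth(4) f(2)]
        gauss_ge_mult_le[OF gauss_ge_0[of "b' + \<gamma>"] f(4)]) linarith+
  show "weight_ge (t + \<mu> - h) (\<mu> - h) (rem G Z)"
    unfolding weight_ge_def using 11 12 21 22[of "b' + (t + \<mu> - h) - (\<mu> - h)"] ineqs by auto
  show "gauss_ge (a' + t + \<mu> - h) (rem G Z $ 2 $ 2)"
    using ineqs by (intro 22) linarith+
qed

text \<open>Handles the quadratic part of the equation. Here \<open>M\<close> carries no penalty,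
  and its smallness \<epsilon> \<ge> \<mu> supplies the gain, even in products with the penalised
  entry of \<open>Y\<close>.\<close>

lemma weight_ge_mult_phi_corr:
  assumes Y: "weight_ge t h Y" and M: "weight_ge \<epsilon> 0 M" and h: "0 \<le> h" "h \<le> \<mu>"
  shows "weight_ge (t + \<mu> - h) (\<mu> - h) (Y ** \<Phi> (corr M))"
proof -
  note f = phi_corr_ge[OF M]
  have y: "gauss_ge (a' + t) (Y $ 1 $ 1)" "gauss_ge (real a + t) (Y $ 1 $ 2)"
    "gauss_ge (real b + t) (Y $ 2 $ 1)" "gauss_ge (b' + t - h) (Y $ 2 $ 2)"
    using Y by (simp_all add: weight_ge_def)
  note ineqs = h \<mu> N(2) K_ge ab a'_le_b'
  show ?thesis
    unfolding weight_ge_def matrix_mult_2 using ineqs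
    by (intro conjI gauss_ge_add gauss_ge_mult_le[OF y(1) f(1)] gauss_ge_mult_le[OF y(2) f(3)]
        gauss_ge_mult_le[OF y(1) f(2)] gauss_ge_mult_le[OF y(2) f(4)]
        gauss_ge_mult_le[OF y(3) f(1)] gauss_ge_mult_le[OF y(4) f(3)]
        gauss_ge_mult_le[OF y(3) f(2)] gauss_ge_mult_le[OF y(4) f(4)]) linarith+
qed

section \<open>Contraction and fixed point\<close>

lemma trunc_diff: "trunc (M - M') = trunc M - trunc M'"
  by (simp add: matrix_eq_2 trunc_le_def fps_cutoff_diff)

lemma trunc_trunc: "trunc (trunc M) = trunc M"
  by (simp add: matrix_eq_2 trunc_le_def fps_eq_iff)

lemma corr_diff: "corr (M - M') = corr M - corr M'"
  by (simp add: matrix_eq_2 corr_def tail_quot_diff)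

text \<open>\<open>step\<close> is affine except for the product of \<open>trunc M\<close> with
  \<open>\<Phi> (corr M)\<close>; the last term is what remains when the difference of two such
  products is split bilinearly.\<close>

lemma step_diff:
  "step M - step M' = rem (trunc D - trunc M) (M - M') - trunc (M - M') ** \<Phi> (corr M')"
  by (simp add: step_def rem_def matrix_eq_2 matrix_mult_2 corr_diff phi_diff trunc_diff
      trunc_le_def fps_cutoff_diff algebra_simps)

text \<open>Since \<gamma> \<le> \<epsilon>, the candidate \<open>C'\<close> stays as close to
  \<open>C0\<close> as \<open>C\<close> is.\<close>

lemma weight_ge_coeff:
  assumes "weight_ge \<epsilon> 0 M"
  shows "weight_ge \<gamma> 0 (trunc D - trunc M)"
  using weight_ge_trunc[OF weight_ge_D] weight_ge_mono[OF weight_ge_trunc[OF assms]] \<gamma>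
  by (auto intro: weight_ge_diff)

text \<open>The value \<mu> / 2 is the fixed point of the change of penalty from \<open>h\<close> to
  \<open>\<mu> - h\<close>, so the penalty is preserved while the weight improves by \<mu> /
  2.\<close>

lemma step_contraction:
  assumes M: "weight_ge \<epsilon> 0 M" "weight_ge \<epsilon> 0 M'" and Z: "weight_ge t (\<mu> / 2) (M - M')"
  shows "weight_ge (t + \<mu> / 2) (\<mu> / 2) (step M - step M')"
proof -
  have h: "0 \<le> \<mu> / 2" "\<mu> / 2 \<le> \<mu>" using \<mu>(1) by auto
  have "t + \<mu> - \<mu> / 2 = t + \<mu> / 2" "\<mu> - \<mu> / 2 = \<mu> / 2" by auto
  then show ?thesis
    unfolding step_diff
    using weight_ge_diff[OF rem_ge(1)[OF weight_ge_coeff[OF M(1)] Z h]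
        weight_ge_mult_phi_corr[OF weight_ge_trunc[OF Z] M(2) h]] by metis
qed

text \<open>With \<open>h = 0\<close> the new penalty \<mu> is paid for by the gain \<mu>, so the
  ball without penalty is mapped to itself.\<close>

lemma step_ge:
  assumes M: "weight_ge \<epsilon> 0 M"
  shows "weight_ge \<epsilon> 0 (step M)"
proof -
  have "weight_ge \<epsilon> 0 (rem (trunc D - trunc M) M)"
    using weight_ge_mono[OF rem_ge(1)[OF weight_ge_coeff[OF M] M], of \<epsilon> 0] \<mu>(1) by simp
  then show ?thesis
    unfolding step_def using weight_ge_diff weight_ge_tail by blast
qed

lemma trunc_R: "trunc M \<in> M2_R v m"
  by (simp add: M2_R_iff trunc_le_def R_ring_cutoff)

lemma C0_R: "C0 \<in> M2_R v m"
  by (simp add: M2_R_iff C0_def R_ring_0 R_ring_monom)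

lemma corr_R: "M \<in> M2_R v m \<Longrightarrow> corr M \<in> M2_R v m"
  by (simp add: M2_R_iff corr_def R_ring_tail_quot)

lemma step_R:
  assumes "M \<in> M2_R v m"
  shows "step M \<in> M2_R v m"
  unfolding step_def rem_def
  by (intro M2_R_add M2_R_diff M2_R_mult M2_R_phi corr_R assms D_R trunc_R p C0_R)

lemma step_fixed_point:
  obtains M where "M \<in> M2_R v m" "weight_ge \<epsilon> 0 M" "step M = M"
proof -
  define S where "S n = (step ^^ n) 0" for n
  define \<kappa> where "\<kappa> = \<mu> / 2"
  have \<kappa>: "0 < \<kappa>" using \<mu>(1) by (simp add: \<kappa>_def)
  have S_Suc: "S (Suc n) = step (S n)" for n by (simp add: S_def)
  have S0: "S 0 = 0" by (simp add: S_def)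
  have SR: "S n \<in> M2_R v m" for n
    by (induction n) (auto simp: S0 S_Suc step_R M2_R_iff[of 0] R_ring_0)
  have S_ge: "weight_ge \<epsilon> 0 (S n)" for n
  proof (induction n)
    case 0
    show ?case by (simp add: S0 weight_ge_def)
  qed (simp add: S_Suc step_ge)
  have diff: "weight_ge (\<epsilon> + real n * \<kappa>) \<kappa> (S (Suc n) - S n)" for n
  proof (induction n)
    case 0
    show ?case using weight_ge_mono[OF S_ge[of 1]] \<kappa> by (simp add: S0)
  next
    case (Suc n)
    then show ?case
      using step_contraction[OF S_ge S_ge, of "\<epsilon> + real n * \<kappa>" "Suc n" n]
      unfolding S_Suc[symmetric] \<kappa>_def[symmetric] by (simp add: algebra_simps)
  qed
  have "\<exists>f. f \<in> R_ring v m \<and> (\<forall>n. gauss_ge (w + real n * \<kappa>) (f - S n $ i $ j))"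
    if "\<And>n. gauss_ge (w + real n * \<kappa>) (S (Suc n) $ i $ j - S n $ i $ j)" for w i j
  proof -
    have "S n $ i $ j \<in> R_ring v m" for n
      using SR unfolding M2_R_def by blast
    from R_ring_complete[OF \<kappa> that this] show ?thesis by blast
  qed
  note lim = this
  \<comment> \<open>The penalty lowers the starting weight of the (2,2) entry by \<kappa>, but the
    rate of growth is the same.\<close>
  have entries: "gauss_ge (a' + \<epsilon> + real n * \<kappa>) (S (Suc n) $ 1 $ 1 - S n $ 1 $ 1)"
    "gauss_ge (real a + \<epsilon> + real n * \<kappa>) (S (Suc n) $ 1 $ 2 - S n $ 1 $ 2)"
    "gauss_ge (real b + \<epsilon> + real n * \<kappa>) (S (Suc n) $ 2 $ 1 - S n $ 2 $ 1)"
    "gauss_ge (b' + \<epsilon> - \<kappa> + real n * \<kappa>) (S (Suc n) $ 2 $ 2 - S n $ 2 $ 2)" for n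
    using diff[of n] unfolding weight_ge_def vector_minus_component
    by (simp_all add: algebra_simps)
  obtain f where f: "f \<in> R_ring v m" "\<And>n. gauss_ge (a' + \<epsilon> + real n * \<kappa>) (f - S n $ 1 $ 1)"
    using lim[OF entries(1)] by blast
  obtain g where g: "g \<in> R_ring v m" "\<And>n. gauss_ge (real a + \<epsilon> + real n * \<kappa>) (g - S n $ 1 $ 2)"
    using lim[OF entries(2)] by blast
  obtain k where k: "k \<in> R_ring v m" "\<And>n. gauss_ge (real b + \<epsilon> + real n * \<kappa>) (k - S n $ 2 $ 1)"
    using lim[OF entries(3)] by blast
  obtain l where l: "l \<in> R_ring v m" "\<And>n. gauss_ge (b' + \<epsilon> - \<kappa> + real n * \<kappa>) (l - S n $ 2 $ 2)"
    using lim[OF entries(4)] by blast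
  define M where "M = mat2 f g k l"
  have MR: "M \<in> M2_R v m"
    using f g k l by (simp add: M2_R_iff M_def)
  have M_S: "weight_ge (\<epsilon> + real n * \<kappa>) \<kappa> (M - S n)" for n
    using f(2)[of n] g(2)[of n] k(2)[of n] l(2)[of n]
    by (simp add: weight_ge_def M_def algebra_simps)
  \<comment> \<open>Comparison with \<open>S 1\<close> rather than \<open>S 0\<close>: the extra
    \<kappa> of weight cancels the penalty and leaves \<epsilon> in every entry.\<close>
  have M_ge: "weight_ge \<epsilon> 0 M"
  proof -
    have "weight_ge \<epsilon> 0 (M - S 1)"
      using M_S[of 1] by (rule weight_ge_mono) (use \<kappa> in auto)
    from weight_ge_add[OF this S_ge[of 1]] show ?thesis by simp
  qed
  \<comment> \<open>Both \<open>step M\<close> and \<open>M\<close> are close to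
    \<open>S (Suc n)\<close>, the former by contraction, so their difference has unbounded
    weight.\<close>
  have "weight_ge (\<epsilon> + real n * \<kappa>) \<kappa> (step M - M)" for n
  proof -
    have "weight_ge (\<epsilon> + real n * \<kappa> + \<kappa>) \<kappa> (step M - S (Suc n))"
      using step_contraction[OF M_ge S_ge, of "\<epsilon> + real n * \<kappa>" n] M_S[of n]
      unfolding S_Suc \<kappa>_def by simp
    moreover have "weight_ge (\<epsilon> + real n * \<kappa> + \<kappa>) \<kappa> (S (Suc n) - M)"
      using M_S[of "Suc n"] by (simp add: weight_ge_diff_commute[of _ _ M] algebra_simps)
    ultimately have "weight_ge (\<epsilon> + real n * \<kappa> + \<kappa>) \<kappa> (step M - M)"
      using weight_ge_add by fastforce
    then show ?thesis by (rule weight_ge_mono) (use \<kappa> in auto)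
  qed
  then have small: "gauss_ge (a' + \<epsilon> + real n * \<kappa>) ((step M - M) $ 1 $ 1)"
    "gauss_ge (real a + \<epsilon> + real n * \<kappa>) ((step M - M) $ 1 $ 2)"
    "gauss_ge (real b + \<epsilon> + real n * \<kappa>) ((step M - M) $ 2 $ 1)"
    "gauss_ge (b' + \<epsilon> - \<kappa> + real n * \<kappa>) ((step M - M) $ 2 $ 2)" for n
    unfolding weight_ge_def by (simp_all add: algebra_simps)
  have "step M - M = 0"
    unfolding matrix_eq_2 zero_index
    using gauss_ge_limit_imp_0[OF \<kappa> small(1)] gauss_ge_limit_imp_0[OF \<kappa> small(2)]
      gauss_ge_limit_imp_0[OF \<kappa> small(3)] gauss_ge_limit_imp_0[OF \<kappa> small(4)] by blast
  then show ?thesis using that MR M_ge by simp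
qed

section \<open>From the fixed point to the conjugating matrix\<close>

lemma corr_mult_C0: "corr M ** C0 = M - trunc M"
proof -
  have "ca \<noteq> 0" "cb \<noteq> 0" using ca cb by auto
  then show ?thesis
    using monom_mult_tail_quot[of a a ca] monom_mult_tail_quot[of b N cb]
      monom_mult_tail_quot[of b b cb] N(1)
    by (simp add: matrix_eq_2 matrix_mult_2 C0_def corr_def mult.commute[of "tail_quot _ _ _ _"])
qed

theorem exists_conjugate:
  obtains X Y where "\<And>i j. fps_nth (X $ i $ j) 0 = 0" "mat 1 + X \<in> GL2_R v m"
    "(mat 1 + X) ** (C0 + D) = (C0 + trunc D + Y) ** \<Phi> (mat 1 + X)"
    "trunc Y = Y" "gauss_ge (\<epsilon> + a' + \<mu>) (Y $ 1 $ 1)" "gauss_ge (\<epsilon> + a' + \<mu>) (Y $ 2 $ 2)"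
proof -
  obtain M where MR: "M \<in> M2_R v m" and M_ge: "weight_ge \<epsilon> 0 M" and fixed: "step M = M"
    using step_fixed_point .
  define X where "X = corr M"
  define P where "P = rem (trunc D - trunc M) M"
  \<comment> \<open>\<open>Y\<close> is built from \<open>P\<close> rather than \<open>M\<close>:
    the part \<open>D - trunc D\<close> of \<open>M\<close> has only weight \<epsilon>, but
    truncation annihilates it, so \<open>Y\<close> keeps the better bounds of
    \<open>P\<close>.\<close>
  define Y where "Y = - trunc P"
  have MP: "M = P - (D - trunc D)"
    using fixed unfolding step_def P_def by simp
  then have "trunc M = trunc P"
    by (metis trunc_diff trunc_trunc diff_self diff_zero)
  then have Y: "Y = - trunc M" by (simp add: Y_def)
  have "trunc (- trunc P) = - trunc P"
    using trunc_diff[of 0 "trunc P"] trunc_diff[of 0 0] by (simp add: trunc_trunc)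
  then have "trunc Y = Y" by (simp add: Y_def)
  moreover have X: "X \<in> M2_R v m" and X0: "\<And>i j. fps_nth (X $ i $ j) 0 = 0"
    using corr_R[OF MR] corr_nth_0 by (simp_all add: X_def)
  \<comment> \<open>The off-diagonal bounds \<open>\<epsilon> + a' - b\<close> and
    \<open>\<epsilon> + b' - a\<close> add up to \<open>2 * \<epsilon>\<close>, which is at least
    \<epsilon> > 0.\<close>
  moreover have "mat 1 + X \<in> GL2_R v m"
    using GL2_R_mat_1_plus[OF X X0 _ _ corr_ge[OF M_ge, folded X_def]] \<gamma> ab by simp
  moreover have "(mat 1 + X) ** (C0 + D) = (C0 + trunc D + Y) ** \<Phi> (mat 1 + X)"
  proof -
    have "\<Phi> (mat 1 + X) = mat 1 + \<Phi> X"
      by (simp add: matrix_eq_2 phi_add)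
    moreover have "(mat 1 + X) ** (C0 + D) = C0 + D + X ** C0 + X ** D"
      by (simp add: matrix_add_ldistrib matrix_add_rdistrib_2)
    moreover have "X ** C0 = M + Y"
      unfolding X_def corr_mult_C0 Y by simp
    moreover have "P = (trunc D + Y) ** \<Phi> X + C0 ** \<Phi> X - X ** D"
      by (simp add: P_def rem_def X_def Y)
    ultimately show ?thesis
      using MP by (simp add: matrix_add_ldistrib matrix_add_rdistrib_2)
  qed
  \<comment> \<open>With \<open>h = 0\<close> and \<open>t = \<epsilon>\<close>, the first part of
    \<open>rem_ge\<close> gives the (1,1) entry and the second the (2,2) entry.\<close>
  moreover have "gauss_ge (\<epsilon> + a' + \<mu>) (Y $ 1 $ 1)" "gauss_ge (\<epsilon> + a' + \<mu>) (Y $ 2 $ 2)"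
    using rem_ge[OF weight_ge_coeff[OF M_ge] M_ge] \<mu>(1)
    by (simp_all add: Y_def P_def weight_ge_def gauss_ge_trunc_le add_ac)
  ultimately show ?thesis using that by blast
qed

end


text \<open>For \<open>b' > a'\<close> the number \<open>N + 1 - b\<close> is the ceiling of
  \<open>(b' - a') / (p - 1)\<close>, and for \<open>b' = a'\<close> it is 1.\<close>

lemma N_bound_ge:
  assumes p: "2 \<le> p" and le: "a' \<le> b'"
  shows "b \<le> N_bound p b a' b'"
    and "of_rat b' - of_rat a' \<le> (real p - 1) * real (N_bound p b a' b' + 1 - b)"
proof -
  let ?c = "\<lceil>(b' - a') / (of_nat p - 1)\<rceil>"
  have p1: "(0::rat) < of_nat p - 1" using p by simp
  have "b \<le> N_bound p b a' b' \<and> b' - a' \<le> (of_nat p - 1) * of_nat (N_bound p b a' b' + 1 - b)"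
  proof (cases "a' = b'")
    case True
    then show ?thesis using p1 by (simp add: N_bound_def)
  next
    case False
    with le p1 have "0 < (b' - a') / (of_nat p - 1)" by simp
    \<comment> \<open>A positive quotient has ceiling at least 1, so neither \<open>nat\<close> nor
      the final subtraction of 1 truncates.\<close>
    then have c: "1 \<le> ?c" by (simp add: le_ceiling_iff)
    then have N: "N_bound p b a' b' + 1 = b + nat ?c"
      using False by (simp add: N_bound_def) linarith
    have "(b' - a') / (of_nat p - 1) \<le> of_int ?c" by (rule le_of_int_ceiling)
    also have "of_int ?c = (of_nat (nat ?c) :: rat)" using c by simp
    finally have "b' - a' \<le> (of_nat p - 1) * of_nat (nat ?c)"
      using p1 by (simp add: pos_divide_le_eq mult.commute)
    moreover have "b \<le> N_bound p b a' b'" "N_bound p b a' b' + 1 - b = nat ?c"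
      using N c by linarith+
    ultimately show ?thesis by simp
  qed
  note this[THEN conjunct1] this[THEN conjunct2]
  then show "b \<le> N_bound p b a' b'" by simp
  have "(of_rat (b' - a') :: real) \<le> of_rat ((of_nat p - 1) * of_nat (N_bound p b a' b' + 1 - b))"
    unfolding of_rat_less_eq by fact
  then show "of_rat b' - of_rat a' \<le> (real p - 1) * real (N_bound p b a' b' + 1 - b)"
    by (simp add: of_rat_diff of_rat_mult)
qed

section \<open>The operator \<open>T\<close> on entries and the final assembly\<close>

lemma trunc_le_monom: "trunc_le k (fps_const c * fps_X ^ k) = fps_const c * fps_X ^ k"
  by (simp add: trunc_le_def fps_eq_iff fps_X_power_nth)

lemma trunc_le_add: "trunc_le n (f + g) = trunc_le n f + trunc_le n g" for f g :: "'f::field fps"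
  by (simp add: trunc_le_def fps_cutoff_add)

lemma T_nth [simp]: "T p a b a' b' M $ 1 $ 1 = trunc_le (N_bound p b a' b') (M $ 1 $ 1)"
  "T p a b a' b' M $ 1 $ 2 = trunc_le a (M $ 1 $ 2)" "T p a b a' b' M $ 2 $ 1 = trunc_le b (M $ 2 $ 1)"
  "T p a b a' b' M $ 2 $ 2 = trunc_le a (M $ 2 $ 2)"
  by (simp_all add: T_def)

lemma ereal_le_diff_iff: "ereal s \<le> x - ereal t \<longleftrightarrow> ereal (t + s) \<le> x"
  by (cases x) (auto simp: algebra_simps)

theorem theorem4p10:
  fixes p :: nat and v :: "'f::field_char_0 \<Rightarrow> ereal" and m :: real
    and a b :: nat and a' b' :: rat and \<gamma> :: real and C :: "'f fps^2^2"
  assumes "prime p"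
    and "finite_extension_Qp p v"
    and "m > 1"
    and "b' \<ge> a'"
    and "of_nat a + of_nat b = a' + b'"
    and "\<gamma> > 0"
    and "C \<in> M2_R v m"
    and "allowable v m a b a' b' \<gamma> C"
  shows "\<exists>A\<in>GL2_R v m.
    let C' = phi_conj p A C;
        r = err v m p a b a' b' C + ereal (of_rat a') + ereal (min \<gamma> (real p - 1))
    in mod_u C = mod_u C' \<and>
       C' = T p a b a' b' C' \<and>
       (C' - T p a b a' b' C) $ 1 $ 1 \<in> H v m r \<and>
       (C' - T p a b a' b' C) $ 2 $ 2 \<in> H v m r"
proof -
  interpret complete_gauss_valued_field v m
    using assms(2,3) finite_extension_Qp_complete[OF assms(2)]
    by unfold_locales (auto simp: finite_extension_Qp_def)
  have p: "2 \<le> p" using assms(1) by (rule prime_ge_2_nat)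
  let ?T = "T p a b a' b'" and ?E = "E p a b a' b' C" and ?e = "err v m p a b a' b' C"
  have err_ge: "ereal s \<le> ?e \<longleftrightarrow> gauss_ge (of_rat a' + s) (?E $ 1 $ 1) \<and>
      gauss_ge (real a + s) (?E $ 1 $ 2) \<and> gauss_ge (real b + s) (?E $ 2 $ 1) \<and>
      gauss_ge (of_rat b' + s) (?E $ 2 $ 2)" for s
    by (simp add: err_def ereal_le_diff_iff gauss_ge_iff)
  obtain ca cb where cab: "ca \<in> integer_units v" "cb \<in> integer_units v"
    and allow: "let D = C - mat2 0 (fps_const ca * fps_X ^ a) (fps_const cb * fps_X ^ b) 0 in
          D $ 1 $ 1 \<in> H v m (ereal (of_rat a' + \<gamma>)) \<and>
          D $ 1 $ 2 \<in> H v m (ereal (real a + \<gamma>)) \<and>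
          D $ 2 $ 1 \<in> H v m (ereal (real b + \<gamma>)) \<and>
          D $ 2 $ 2 \<in> H v m (ereal (of_rat b' + \<gamma>))"
    using assms(8) unfolding allowable_def by blast
  have unit: "v c = 0" if c: "c \<in> integer_units v" for c
  proof -
    obtain d where "0 \<le> v c" "0 \<le> v d" "c * d = 1"
      using c unfolding integer_units_def ring_of_integers_def by auto
    then have "v c + v d = 0" by (metis v_1 v_mult)
    then show ?thesis using \<open>0 \<le> v c\<close> \<open>0 \<le> v d\<close>
      by (cases "v c"; cases "v d") (auto simp: zero_ereal_def)
  qed
  define C1 where "C1 = mat2 0 (fps_const ca * fps_X ^ a) (fps_const cb * fps_X ^ b) 0"
  define D where "D = C - C1"
  have D_H: "D $ 1 $ 1 \<in> H v m (ereal (of_rat a' + \<gamma>))" "D $ 1 $ 2 \<in> H v m (ereal (real a + \<gamma>))"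
    "D $ 2 $ 1 \<in> H v m (ereal (real b + \<gamma>))" "D $ 2 $ 2 \<in> H v m (ereal (of_rat b' + \<gamma>))"
    using allow unfolding D_def C1_def Let_def by blast+
  have C: "C = C1 + D" by (simp add: D_def)
  \<comment> \<open>The cutoffs \<open>a\<close> and \<open>b\<close> are inclusive, so
    \<open>T\<close> fixes the monomials of \<open>C1\<close> and the whole error comes from
    \<open>D\<close>.\<close>
  have TC: "?T C = C1 + ?T D"
    by (simp add: matrix_eq_2 C C1_def trunc_le_monom trunc_le_add)
  have E: "?E = D - ?T D" by (simp add: E_def TC) (simp add: C)
  \<comment> \<open>Truncation does not lower the Gauss valuation, so the error is at least
    \<gamma>; in particular it is not minus infinity.\<close>
  have "ereal \<gamma> \<le> ?e"
    unfolding err_ge E using D_H by (simp add: H_iff gauss_ge_diff gauss_ge_trunc_le)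
  show ?thesis
  proof (cases "?e = \<infinity>")
    \<comment> \<open>An infinite error means \<open>C = T C\<close>, and the identity matrix serves
      as \<open>A\<close>.\<close>
    case True
    then have "ereal s \<le> ?e" for s by simp
    then have all: "gauss_ge (of_rat a' + s) (?E $ 1 $ 1)" "gauss_ge (real a + s) (?E $ 1 $ 2)"
      "gauss_ge (real b + s) (?E $ 2 $ 1)" "gauss_ge (of_rat b' + s) (?E $ 2 $ 2)" for s
      unfolding err_ge by blast+
    have zero: "f = 0" if "\<And>s. gauss_ge (w + s) f" for w f
    proof (rule gauss_ge_all_imp_0)
      show "gauss_ge t f" for t using that[of "t - w"] by simp
    qed
    have "?E = 0"
      unfolding matrix_eq_2 zero_index
      using zero[OF all(1)] zero[OF all(2)] zero[OF all(3)] zero[OF all(4)] by blast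
    then have "C = ?T C" by (simp add: E_def)
    moreover have "phi_conj p (mat 1) C = C"
      using p by (intro phi_conj_eqI GL2_R_mat_1) simp_all
    ultimately show ?thesis
      using GL2_R_mat_1 zero_in_H by (intro bexI[of _ "mat 1"]) (auto simp: Let_def)
  next
    case False
    then obtain \<epsilon> where \<epsilon>: "?e = ereal \<epsilon>"
      using \<open>ereal \<gamma> \<le> ?e\<close> by (cases ?e) auto
    interpret allowable_matrix v m p a b "N_bound p b a' b'" "of_rat a'" "of_rat b'" \<gamma> \<epsilon> ca cb D
    proof
      have "(of_rat (of_nat a + of_nat b) :: real) = of_rat (a' + b')"
        using assms(5) by simp
      then show "real a + real b = of_rat a' + of_rat b'" by (simp add: of_rat_add)
      show "gauss_ge (of_rat a' + \<epsilon>) (D $ 1 $ 1 - trunc_le (N_bound p b a' b') (D $ 1 $ 1))"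
        "gauss_ge (real a + \<epsilon>) (D $ 1 $ 2 - trunc_le a (D $ 1 $ 2))"
        "gauss_ge (real b + \<epsilon>) (D $ 2 $ 1 - trunc_le b (D $ 2 $ 1))"
        "gauss_ge (of_rat b' + \<epsilon>) (D $ 2 $ 2 - trunc_le a (D $ 2 $ 2))"
        using err_ge[of \<epsilon>] \<epsilon> by (simp_all add: E)
      show "\<gamma> \<le> \<epsilon>" using \<open>ereal \<gamma> \<le> ?e\<close> \<epsilon> by simp
    qed (use p assms(4,6) N_bound_ge[OF p assms(4)] unit[OF cab(1)] unit[OF cab(2)] D_H
        in \<open>auto simp: M2_R_iff H_iff of_rat_less_eq\<close>)
    have trunc: "trunc = ?T" by (simp add: fun_eq_iff trunc_def T_def)
    have C0: "C0 = C1" by (simp add: C0_def C1_def)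
    obtain X Y where X: "\<And>i j. fps_nth (X $ i $ j) 0 = 0" "mat 1 + X \<in> GL2_R v m"
      and eq': "(mat 1 + X) ** (C0 + D) = (C0 + trunc D + Y) ** map_matrix (phi p) (mat 1 + X)"
      and Y': "trunc Y = Y"
      and Y_ge: "gauss_ge (\<epsilon> + of_rat a' + \<mu>) (Y $ 1 $ 1)" "gauss_ge (\<epsilon> + of_rat a' + \<mu>) (Y $ 2 $ 2)"
      by (rule exists_conjugate, rule that)
    have eq: "(mat 1 + X) ** C = (?T C + Y) ** map_matrix (phi p) (mat 1 + X)"
      using eq' by (simp only: trunc C0 C[symmetric] TC[symmetric])
    have Y: "?T Y = Y" using Y' by (simp only: trunc)
    have conj: "phi_conj p (mat 1 + X) C = ?T C + Y"
      using p by (intro phi_conj_eqI X eq) simp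
    have "mod_u C = mod_u (?T C + Y)"
      using p by (intro mod_u_phi_conj[OF _ X(1) eq]) simp
    moreover have "?T C + Y = ?T (?T C + Y)"
      using Y trunc_trunc[of C] unfolding trunc
      by (simp add: matrix_eq_2 trunc_le_add)
    moreover have "Y $ 1 $ 1 \<in> R_ring v m" "Y $ 2 $ 2 \<in> R_ring v m"
      using trunc_R[of Y] unfolding trunc Y by (simp_all add: M2_R_iff)
    ultimately show ?thesis
      using Y_ge by (intro bexI[OF _ X(2)]) (simp add: conj Let_def \<epsilon> H_iff \<mu>_def del: ereal_min)
  qed
qed

end
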